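(* The group $\mathcal{U}(M_{2^{\infty}})_u$ does not have property (T).
   Context: $M_{2^\infty}$ is the UHF algebra of type $2^\infty$ (the CAR algebra), i.e. the infinite $\mathrm{C}^*$-tensor product $\bigotimes_{n=1}^\infty M_2(\mathbb{C})$. For a unital $\mathrm{C}^*$-algebra $A$, $\mathcal{U}(A)_u$ is its unitary group equipped with the norm topology. Property (T): let $G$ be a topological group and $\rho\colon G\to\mathcal{U}(H)$ a strongly continuous unitary representation. For nonempty $Q\subset G$ and $\varepsilon>0$, a vector $\xi\in H$ is $(Q,\varepsilon)$-invariant if $\sup_{x\in Q}\|\rho(x)\xi-\xi\|<\varepsilon\|\xi\|$. $\rho$ almost has invariant vectors if it has a $(Q,\varepsilon)$-invariant vector for every compact $Q\subset G$ and every $\varepsilon>0$. $G$ has property (T) if every strongly continuous unitary representation of $G$ which almost has invariant vectors admits a nonzero invariant vector. *)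

theory Defs
  imports
    "HOL-Analysis.Analysis"
    "HOL-Algebra.Algebraic_Closure_Type"
    "HOL-Algebra.Module"
    "HOL-Algebra.Bij"
begin

section \<open>Property (T) for topological groups\<close>

definition topological_group :: "('g, 'm) monoid_scheme \<Rightarrow> 'g topology \<Rightarrow> bool" where
  "topological_group G T \<longleftrightarrow>
     group G \<and> topspace T = carrier G \<and>
     continuous_map (prod_topology T T) T (\<lambda>(x, y). x \<otimes>\<^bsub>G\<^esub> y) \<and>
     continuous_map T T (\<lambda>x. inv\<^bsub>G\<^esub> x)"

text \<open>Complex Hilbert spaces with an explicit carrier. The fields \<open>mult\<close> and \<open>one\<close> that the
  library's modules inherit from rings play no role.\<close>

record 'h hilbert = "(complex, 'h) module" +
  hinner :: "'h \<Rightarrow> 'h \<Rightarrow> complex"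

definition hnorm :: "('h, 'm) hilbert_scheme \<Rightarrow> 'h \<Rightarrow> real" where
  "hnorm H x = sqrt (Re (hinner H x x))"

definition hdist :: "('h, 'm) hilbert_scheme \<Rightarrow> 'h \<Rightarrow> 'h \<Rightarrow> real" where
  "hdist H x y = hnorm H (x \<ominus>\<^bsub>H\<^esub> y)"

locale hilbert_space = Module.module "ring_of_type_algebra :: complex ring" H
  for H :: "('h, 'm) hilbert_scheme" (structure) +
  assumes hinner_add_right:
      "\<lbrakk>x \<in> carrier H; y \<in> carrier H; z \<in> carrier H\<rbrakk>
        \<Longrightarrow> hinner H x (y \<oplus> z) = hinner H x y + hinner H x z"
    and hinner_smult_right:
      "\<lbrakk>x \<in> carrier H; y \<in> carrier H\<rbrakk> \<Longrightarrow> hinner H x (c \<odot> y) = c * hinner H x y"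
    and hinner_cnj:
      "\<lbrakk>x \<in> carrier H; y \<in> carrier H\<rbrakk> \<Longrightarrow> hinner H y x = cnj (hinner H x y)"
    and hinner_nonneg: "x \<in> carrier H \<Longrightarrow> 0 \<le> Re (hinner H x x)"
    and hinner_definite: "\<lbrakk>x \<in> carrier H; hinner H x x = 0\<rbrakk> \<Longrightarrow> x = \<zero>"
    and complete: "Metric_space.mcomplete (carrier H) (hdist H)"

text \<open>The unitary group of a Hilbert space, as a subgroup of the permutations of its carrier.\<close>

definition hunitary :: "('h, 'm) hilbert_scheme \<Rightarrow> ('h \<Rightarrow> 'h) monoid" where
  "hunitary H = (BijGroup (carrier H))
     \<lparr>carrier := {U \<in> Bij (carrier H).
        (\<forall>x\<in>carrier H. \<forall>y\<in>carrier H. U (x \<oplus>\<^bsub>H\<^esub> y) = U x \<oplus>\<^bsub>H\<^esub> U y) \<and>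
        (\<forall>c. \<forall>x\<in>carrier H. U (c \<odot>\<^bsub>H\<^esub> x) = c \<odot>\<^bsub>H\<^esub> U x) \<and>
        (\<forall>x\<in>carrier H. \<forall>y\<in>carrier H. hinner H (U x) (U y) = hinner H x y)}\<rparr>"

definition unitary_rep ::
  "('g, 'm) monoid_scheme \<Rightarrow> 'g topology \<Rightarrow> ('h, 'n) hilbert_scheme \<Rightarrow> ('g \<Rightarrow> 'h \<Rightarrow> 'h) \<Rightarrow> bool"
  where
  "unitary_rep G T H \<rho> \<longleftrightarrow>
     \<rho> \<in> hom G (hunitary H) \<and>
     (\<forall>\<xi>\<in>carrier H.
        continuous_map T (Metric_space.mtopology (carrier H) (hdist H)) (\<lambda>g. \<rho> g \<xi>))"

definition almost_invariant_vector ::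
  "('h, 'n) hilbert_scheme \<Rightarrow> ('g \<Rightarrow> 'h \<Rightarrow> 'h) \<Rightarrow> 'g set \<Rightarrow> real \<Rightarrow> 'h \<Rightarrow> bool" where
  "almost_invariant_vector H \<rho> Q \<epsilon> \<xi> \<longleftrightarrow>
     \<xi> \<in> carrier H \<and> (SUP x\<in>Q. hnorm H (\<rho> x \<xi> \<ominus>\<^bsub>H\<^esub> \<xi>)) < \<epsilon> * hnorm H \<xi>"

definition almost_has_invariant_vectors ::
  "'g topology \<Rightarrow> ('h, 'n) hilbert_scheme \<Rightarrow> ('g \<Rightarrow> 'h \<Rightarrow> 'h) \<Rightarrow> bool" where
  "almost_has_invariant_vectors T H \<rho> \<longleftrightarrow>
     (\<forall>Q \<epsilon>. compactin T Q \<and> Q \<noteq> {} \<and> 0 < \<epsilon> \<longrightarrow> (\<exists>\<xi>. almost_invariant_vector H \<rho> Q \<epsilon> \<xi>))"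

definition has_invariant_vector ::
  "('g, 'm) monoid_scheme \<Rightarrow> ('h, 'n) hilbert_scheme \<Rightarrow> ('g \<Rightarrow> 'h \<Rightarrow> 'h) \<Rightarrow> bool" where
  "has_invariant_vector G H \<rho> \<longleftrightarrow>
     (\<exists>\<xi>\<in>carrier H. \<xi> \<noteq> \<zero>\<^bsub>H\<^esub> \<and> (\<forall>g\<in>carrier G. \<rho> g \<xi> = \<xi>))"

text \<open>A definition cannot quantify over all types, so the carriers of the Hilbert spaces are
  taken inside the function type below; up to isomorphism these include all Hilbert
  spaces of dimension at most the cardinality of the index type \<open>'g set \<times> nat \<times> 'g\<close>.
  This bound loses nothing. If a representation \<open>\<rho>\<close> on a Hilbert space of any
  size almost has invariant vectors but no nonzero invariant one, choose a \<open>(Q, 1/(n+1))\<close>-invariant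
  vector \<open>\<xi>(Q, n)\<close> for each compact \<open>Q\<close> and each \<open>n\<close>. The closed linear span of the
  vectors \<open>\<rho>(g) \<xi>(Q, n)\<close> is an invariant subspace on which the same holds, and it is spanned by a
  family indexed by the triples \<open>(Q, n, g)\<close>.\<close>

type_synonym 'g rep_space = "('g set \<times> nat \<times> 'g \<Rightarrow> complex) hilbert"

definition property_T :: "('g, 'm) monoid_scheme \<Rightarrow> 'g topology \<Rightarrow> bool" where
  "property_T G T \<longleftrightarrow>
     (\<forall>(H :: 'g rep_space) \<rho>.
        hilbert_space H \<and> unitary_rep G T H \<rho> \<and> almost_has_invariant_vectors T H \<rho>
        \<longrightarrow> has_invariant_vector G H \<rho>)"


section \<open>The Hilbert space of square-summable functions\<close>

definition square_summable :: "('i \<Rightarrow> complex) \<Rightarrow> bool" where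
  "square_summable f \<longleftrightarrow> (\<lambda>i. (cmod (f i))\<^sup>2) summable_on UNIV"

lemma square_summable_0: "square_summable (\<lambda>_. 0)"
  by (simp add: square_summable_def)

lemma cmod_add_square: "(cmod (a + b))\<^sup>2 \<le> 2 * (cmod a)\<^sup>2 + 2 * (cmod b)\<^sup>2"
proof -
  have "(cmod (a + b))\<^sup>2 \<le> (cmod a + cmod b)\<^sup>2"
    by (intro power_mono norm_triangle_ineq) auto
  also have "\<dots> \<le> 2 * (cmod a)\<^sup>2 + 2 * (cmod b)\<^sup>2"
    using zero_le_power2[of "cmod a - cmod b"] by (simp add: power2_eq_square algebra_simps)
  finally show ?thesis .
qed

lemma square_summable_add:
  assumes "square_summable f" "square_summable g"
  shows "square_summable (\<lambda>i. f i + g i)"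
  unfolding square_summable_def
proof (rule summable_on_comparison_test)
  show "(\<lambda>i. 2 * (cmod (f i))\<^sup>2 + 2 * (cmod (g i))\<^sup>2) summable_on UNIV"
    using assms unfolding square_summable_def
    by (intro summable_on_add summable_on_cmult_right)
qed (auto simp: cmod_add_square)

lemma square_summable_mult:
  assumes "square_summable f"
  shows "square_summable (\<lambda>i. c * f i)"
  using assms unfolding square_summable_def norm_mult power_mult_distrib
  by (intro summable_on_cmult_right)

lemma square_summable_inner:
  assumes "square_summable f" "square_summable g"
  shows "(\<lambda>i. cnj (f i) * g i) summable_on UNIV"
proof (rule abs_summable_summable, rule summable_on_comparison_test)
  show "(\<lambda>i. (cmod (f i))\<^sup>2 + (cmod (g i))\<^sup>2) summable_on UNIV"
    using assms unfolding square_summable_def by (intro summable_on_add)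
next
  fix i
  have "2 * (cmod (f i) * cmod (g i)) \<le> (cmod (f i))\<^sup>2 + (cmod (g i))\<^sup>2"
    using zero_le_power2[of "cmod (f i) - cmod (g i)"]
    by (simp add: power2_eq_square algebra_simps)
  moreover have "0 \<le> cmod (f i) * cmod (g i)" by simp
  ultimately have "cmod (f i) * cmod (g i) \<le> (cmod (f i))\<^sup>2 + (cmod (g i))\<^sup>2" by linarith
  then show "norm (cnj (f i) * g i) \<le> (cmod (f i))\<^sup>2 + (cmod (g i))\<^sup>2"
    by (simp add: norm_mult)
qed auto

typedef 'i ell2 = "{f :: 'i \<Rightarrow> complex. square_summable f}"
  morphisms ell2_apply Abs_ell2
  using square_summable_0 by auto

setup_lifting type_definition_ell2

lift_definition cinner :: "'i ell2 \<Rightarrow> 'i ell2 \<Rightarrow> complex"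
  is "\<lambda>f g. \<Sum>\<^sub>\<infinity>i. cnj (f i) * g i" .

lemma cinner_commute: "cinner y x = cnj (cinner x y)"
  by transfer (simp add: mult.commute flip: infsum_cnj)

lemma summable_ell2: "(\<lambda>i. (cmod (ell2_apply x i))\<^sup>2) summable_on UNIV"
  using ell2_apply[of x] by (simp add: square_summable_def)

lemma cinner_self: "cinner x x = of_real (\<Sum>\<^sub>\<infinity>i. (cmod (ell2_apply x i))\<^sup>2)"
proof -
  have "((\<lambda>i. complex_of_real ((cmod (ell2_apply x i))\<^sup>2)) has_sum
      of_real (\<Sum>\<^sub>\<infinity>i. (cmod (ell2_apply x i))\<^sup>2)) UNIV"
    by (intro has_sum_of_real has_sum_infsum summable_ell2)
  moreover have "complex_of_real ((cmod z)\<^sup>2) = cnj z * z" for z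
    by (simp only: complex_norm_square mult.commute)
  ultimately show ?thesis
    unfolding cinner.rep_eq by (simp only: infsumI)
qed

instantiation ell2 :: (type) real_inner
begin

lift_definition zero_ell2 :: "'a ell2" is "\<lambda>_. 0"
  by (rule square_summable_0)

lift_definition plus_ell2 :: "'a ell2 \<Rightarrow> 'a ell2 \<Rightarrow> 'a ell2" is "\<lambda>f g i. f i + g i"
  by (rule square_summable_add)

lift_definition uminus_ell2 :: "'a ell2 \<Rightarrow> 'a ell2" is "\<lambda>f i. - f i"
  by (simp add: square_summable_def)

lift_definition scaleR_ell2 :: "real \<Rightarrow> 'a ell2 \<Rightarrow> 'a ell2" is "\<lambda>r f i. of_real r * f i"
  by (rule square_summable_mult)

definition minus_ell2 :: "'a ell2 \<Rightarrow> 'a ell2 \<Rightarrow> 'a ell2" where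
  "minus_ell2 x y = x + (- y)"

definition inner_ell2 :: "'a ell2 \<Rightarrow> 'a ell2 \<Rightarrow> real" where
  "inner_ell2 x y = Re (cinner x y)"

definition norm_ell2 :: "'a ell2 \<Rightarrow> real" where
  "norm_ell2 x = sqrt (inner x x)"

definition dist_ell2 :: "'a ell2 \<Rightarrow> 'a ell2 \<Rightarrow> real" where
  "dist_ell2 x y = norm (x - y)"

definition sgn_ell2 :: "'a ell2 \<Rightarrow> 'a ell2" where
  "sgn_ell2 x = scaleR (inverse (norm x)) x"

definition uniformity_ell2 :: "('a ell2 \<times> 'a ell2) filter" where
  "uniformity_ell2 = (INF e\<in>{0<..}. principal {(x, y). dist x y < e})"

definition open_ell2 :: "'a ell2 set \<Rightarrow> bool" where
  "open_ell2 U \<longleftrightarrow> (\<forall>x\<in>U. eventually (\<lambda>(x', y). x' = x \<longrightarrow> y \<in> U) uniformity)"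

instance
proof
  fix x y z :: "'a ell2" and r s :: real
  show "x + y + z = x + (y + z)" by transfer (auto simp: algebra_simps)
  show "x + y = y + x" by transfer (auto simp: algebra_simps)
  show "0 + x = x" by transfer auto
  show "- x + x = 0" by transfer auto
  show "x - y = x + - y" by (simp add: minus_ell2_def)
  show "r *\<^sub>R (x + y) = r *\<^sub>R x + r *\<^sub>R y" by transfer (auto simp: algebra_simps)
  show "(r + s) *\<^sub>R x = r *\<^sub>R x + s *\<^sub>R x" by transfer (auto simp: algebra_simps)
  show "r *\<^sub>R s *\<^sub>R x = (r * s) *\<^sub>R x" by transfer (auto simp: algebra_simps)
  show "1 *\<^sub>R x = x" by transfer auto
  show "sgn x = inverse (norm x) *\<^sub>R x" by (simp add: sgn_ell2_def)
  show "dist x y = norm (x - y)" by (rule dist_ell2_def)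
  show "(uniformity :: ('a ell2 \<times> 'a ell2) filter) =
      (INF e\<in>{0<..}. principal {(x, y). dist x y < e})"
    by (rule uniformity_ell2_def)
  show "open U \<longleftrightarrow> (\<forall>x\<in>U. eventually (\<lambda>(x', y). x' = x \<longrightarrow> y \<in> U) uniformity)"
    for U :: "'a ell2 set"
    by (rule open_ell2_def)
  show "norm x = sqrt (inner x x)" by (rule norm_ell2_def)
  show "inner x y = inner y x"
    by (simp add: inner_ell2_def cinner_commute[of y x])
  have "cinner (x + y) z = cinner x z + cinner y z"
  proof transfer
    fix f g h :: "'a \<Rightarrow> complex"
    assume "square_summable f" "square_summable g" "square_summable h"
    then show "(\<Sum>\<^sub>\<infinity>i. cnj (f i + g i) * h i) =
        (\<Sum>\<^sub>\<infinity>i. cnj (f i) * h i) + (\<Sum>\<^sub>\<infinity>i. cnj (g i) * h i)"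
      by (simp add: square_summable_inner distrib_right flip: infsum_add)
  qed
  then show "inner (x + y) z = inner x z + inner y z"
    by (simp add: inner_ell2_def)
  have "cinner (r *\<^sub>R x) y = of_real r * cinner x y"
    by transfer (simp add: mult.assoc infsum_cmult_right')
  then show "inner (r *\<^sub>R x) y = r * inner x y"
    by (simp add: inner_ell2_def)
  show "0 \<le> inner x x"
    unfolding inner_ell2_def cinner_self by (simp add: infsum_nonneg)
  show "inner x x = 0 \<longleftrightarrow> x = 0"
  proof
    assume "inner x x = 0"
    then have *: "(\<Sum>\<^sub>\<infinity>i. (cmod (ell2_apply x i))\<^sup>2) = 0"
      unfolding inner_ell2_def cinner_self by simp
    have "(cmod (ell2_apply x i))\<^sup>2 = 0" for i
      using nonneg_infsum_le_0D[of "\<lambda>i. (cmod (ell2_apply x i))\<^sup>2" UNIV i] *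
        summable_ell2[of x] by auto
    then show "x = 0"
      by transfer auto
  next
    assume "x = 0"
    then show "inner x x = 0"
      unfolding inner_ell2_def by transfer simp
  qed
qed

end

lemma power2_norm_ell2: "(norm x)\<^sup>2 = (\<Sum>\<^sub>\<infinity>i. (cmod (ell2_apply x i))\<^sup>2)"
  by (simp add: power2_norm_eq_inner inner_ell2_def cinner_self)


section \<open>The CAR algebra\<close>

text \<open>
  \<open>site k m\<close> lets the matrix \<open>m\<close> act on the \<open>k\<close>-th coordinate of the configuration
  space \<open>nat \<Rightarrow> 2\<close>. It stands for \<open>1 \<otimes> \<dots> \<otimes> 1 \<otimes> m \<otimes> 1 \<otimes> \<dots>\<close> with \<open>m\<close> at position \<open>k\<close>.
\<close>

type_synonym configuration = "nat \<Rightarrow> 2"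

definition site_fun :: "nat \<Rightarrow> complex^2^2 \<Rightarrow> (configuration \<Rightarrow> complex) \<Rightarrow> configuration \<Rightarrow> complex"
  where "site_fun k m f s = (\<Sum>b\<in>UNIV. m $ s k $ b * f (s(k := b)))"

lemma sum_site_le:
  fixes f :: "configuration \<Rightarrow> complex"
  assumes f: "square_summable f" and F: "finite F"
  shows "(\<Sum>s\<in>F. (cmod (f (s(k := b))))\<^sup>2) \<le> 2 * (\<Sum>\<^sub>\<infinity>s. (cmod (f s))\<^sup>2)"
proof -
  define S where "S = (\<Sum>\<^sub>\<infinity>s. (cmod (f s))\<^sup>2)"
  define F' where "F' c = {s \<in> F. s k = c}" for c :: 2
  have *: "(\<Sum>s\<in>F' c. (cmod (f (s(k := b))))\<^sup>2) \<le> S" for c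
  proof -
    have inj: "inj_on (\<lambda>s. s(k := b)) (F' c)"
    proof (rule inj_onI)
      fix s t assume st: "s \<in> F' c" "t \<in> F' c" "s(k := b) = t(k := b)"
      show "s = t"
      proof
        fix j show "s j = t j"
          using st by (cases "j = k") (simp add: F'_def, metis fun_upd_other)
      qed
    qed
    have "(\<Sum>s\<in>F' c. (cmod (f (s(k := b))))\<^sup>2) = (\<Sum>s\<in>(\<lambda>s. s(k := b)) ` F' c. (cmod (f s))\<^sup>2)"
      by (simp add: sum.reindex[OF inj])
    also have "\<dots> \<le> S"
      unfolding S_def using f F
      by (intro finite_sum_le_infsum) (auto simp: square_summable_def F'_def)
    finally show ?thesis .
  qed
  have "F = F' 1 \<union> F' 2"
  proof (rule Set.set_eqI)
    fix s :: configuration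
    have "s k = 1 \<or> s k = 2" by (rule exhaust_2)
    then show "s \<in> F \<longleftrightarrow> s \<in> F' 1 \<union> F' 2" unfolding F'_def by blast
  qed
  moreover have "(1 :: 2) \<noteq> 2" by simp
  then have "F' 1 \<inter> F' 2 = {}" unfolding F'_def by fastforce
  moreover have "finite (F' c)" for c using F by (simp add: F'_def)
  ultimately have "(\<Sum>s\<in>F. (cmod (f (s(k := b))))\<^sup>2) =
      (\<Sum>s\<in>F' 1. (cmod (f (s(k := b))))\<^sup>2) + (\<Sum>s\<in>F' 2. (cmod (f (s(k := b))))\<^sup>2)"
    by (metis (no_types, lifting) sum.union_disjoint)
  then show ?thesis
    using *[of 1] *[of 2] by (simp add: S_def)
qed

lemma site_fun_bound:
  obtains C where "0 \<le> C"
    "\<And>f F. square_summable f \<Longrightarrow> finite F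
      \<Longrightarrow> (\<Sum>s\<in>F. (cmod (site_fun k m f s))\<^sup>2) \<le> C * (\<Sum>\<^sub>\<infinity>s. (cmod (f s))\<^sup>2)"
proof -
  define M where "M = (\<Sum>a\<in>UNIV. \<Sum>b\<in>UNIV. (cmod (m $ a $ b))\<^sup>2)"
  have M: "(cmod (m $ a $ b))\<^sup>2 \<le> M" for a b
  proof -
    have "(cmod (m $ a $ b))\<^sup>2 \<le> (\<Sum>b\<in>UNIV. (cmod (m $ a $ b))\<^sup>2)"
      by (rule member_le_sum) auto
    also have "\<dots> \<le> M"
      unfolding M_def by (rule member_le_sum) (auto intro: sum_nonneg)
    finally show ?thesis .
  qed
  have "0 \<le> M" by (simp add: M_def sum_nonneg)
  show thesis
  proof (rule that[of "8 * M"])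
    show "0 \<le> 8 * M" using \<open>0 \<le> M\<close> by simp
    fix f :: "configuration \<Rightarrow> complex" and F :: "configuration set"
    assume f: "square_summable f" and F: "finite F"
    have pt: "(cmod (site_fun k m f s))\<^sup>2 \<le>
        2 * (M * (cmod (f (s(k := 1))))\<^sup>2) + 2 * (M * (cmod (f (s(k := 2))))\<^sup>2)" for s
    proof -
      have "(cmod (site_fun k m f s))\<^sup>2 \<le>
          2 * (cmod (m $ s k $ 1 * f (s(k := 1))))\<^sup>2 + 2 * (cmod (m $ s k $ 2 * f (s(k := 2))))\<^sup>2"
        unfolding site_fun_def sum_2 by (rule cmod_add_square)
      also have "\<dots> \<le> 2 * (M * (cmod (f (s(k := 1))))\<^sup>2) + 2 * (M * (cmod (f (s(k := 2))))\<^sup>2)"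
        unfolding norm_mult power_mult_distrib
        by (intro add_mono mult_left_mono mult_right_mono M) auto
      finally show ?thesis .
    qed
    have "(\<Sum>s\<in>F. (cmod (site_fun k m f s))\<^sup>2) \<le>
        (\<Sum>s\<in>F. 2 * (M * (cmod (f (s(k := 1))))\<^sup>2) + 2 * (M * (cmod (f (s(k := 2))))\<^sup>2))"
      by (rule sum_mono) (rule pt)
    also have "\<dots> = 2 * M * (\<Sum>s\<in>F. (cmod (f (s(k := 1))))\<^sup>2) + 2 * M * (\<Sum>s\<in>F. (cmod (f (s(k := 2))))\<^sup>2)"
      by (simp add: sum.distrib sum_distrib_left mult.assoc)
    also have "\<dots> \<le> 2 * M * (2 * (\<Sum>\<^sub>\<infinity>s. (cmod (f s))\<^sup>2)) + 2 * M * (2 * (\<Sum>\<^sub>\<infinity>s. (cmod (f s))\<^sup>2))"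
      using \<open>0 \<le> M\<close> by (intro add_mono mult_left_mono sum_site_le f F) auto
    finally show "(\<Sum>s\<in>F. (cmod (site_fun k m f s))\<^sup>2) \<le> 8 * M * (\<Sum>\<^sub>\<infinity>s. (cmod (f s))\<^sup>2)"
      by simp
  qed
qed

lemma square_summable_site:
  assumes "square_summable f"
  shows "square_summable (site_fun k m f)"
proof -
  obtain C where C: "\<And>F. finite F
      \<Longrightarrow> (\<Sum>s\<in>F. (cmod (site_fun k m f s))\<^sup>2) \<le> C * (\<Sum>\<^sub>\<infinity>s. (cmod (f s))\<^sup>2)"
    using site_fun_bound[of k m] assms by metis
  show ?thesis
    unfolding square_summable_def
    by (rule nonneg_bdd_above_summable_on) (auto intro!: bdd_aboveI2 C)
qed

lift_definition site_ell2 :: "nat \<Rightarrow> complex^2^2 \<Rightarrow> configuration ell2 \<Rightarrow> configuration ell2"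
  is site_fun
  by (rule square_summable_site)

type_synonym car_operator = "configuration ell2 \<Rightarrow>\<^sub>L configuration ell2"

lift_definition site :: "nat \<Rightarrow> complex^2^2 \<Rightarrow> car_operator" is site_ell2
proof -
  fix k and m :: "complex^2^2"
  obtain C where C: "0 \<le> C" "\<And>f F. square_summable f \<Longrightarrow> finite F
      \<Longrightarrow> (\<Sum>s\<in>F. (cmod (site_fun k m f s))\<^sup>2) \<le> C * (\<Sum>\<^sub>\<infinity>s. (cmod (f s))\<^sup>2)"
    using site_fun_bound[of k m] by metis
  show "bounded_linear (site_ell2 k m)"
  proof
    show "site_ell2 k m (x + y) = site_ell2 k m x + site_ell2 k m y" for x y
      by transfer (simp add: site_fun_def fun_eq_iff sum.distrib algebra_simps)
    show "site_ell2 k m (r *\<^sub>R x) = r *\<^sub>R site_ell2 k m x" for r x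
      by transfer (simp add: site_fun_def fun_eq_iff sum_distrib_left algebra_simps)
    have "norm (site_ell2 k m x) \<le> norm x * sqrt C" for x
    proof -
      have "(norm (site_ell2 k m x))\<^sup>2 \<le> C * (norm x)\<^sup>2"
        unfolding power2_norm_ell2 site_ell2.rep_eq
        using C(2)[of "ell2_apply x"] ell2_apply[of x] square_summable_site[of "ell2_apply x" k m]
        by (intro infsum_le_finite_sums) (auto simp: square_summable_def)
      also have "\<dots> = (norm x * sqrt C)\<^sup>2"
        using C(1) by (simp add: power_mult_distrib)
      finally show ?thesis
        by (rule power2_le_imp_le) (simp add: C(1))
    qed
    then show "\<exists>K. \<forall>x. norm (site_ell2 k m x) \<le> norm x * K" by blast
  qed
qed

text \<open>\<open>elementary_tensor a n\<close> is \<open>a 0 \<otimes> \<dots> \<otimes> a (n - 1) \<otimes> 1 \<otimes> 1 \<otimes> \<dots>\<close>.\<close>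

primrec elementary_tensor :: "(nat \<Rightarrow> complex^2^2) \<Rightarrow> nat \<Rightarrow> car_operator" where
  "elementary_tensor a 0 = id_blinfun"
| "elementary_tensor a (Suc n) = elementary_tensor a n o\<^sub>L site n (a n)"

text \<open>For \<open>n > 0\<close>, \<open>tensor_power n\<close> is the \<open>n\<close>-th tensor power of the algebra of complex
  2 by 2 matrices; the real span is closed under complex scalars because these can be absorbed into
  \<open>a 0\<close>. The \<open>tensor_power n\<close> increase with \<open>n\<close>, with inclusions \<open>x \<mapsto> x \<otimes> 1\<close>. Since the
  C*-norm on a matrix algebra is unique, the closure of their union in operator norm is the
  infinite C*-tensor product. (The ambient space \<open>\<ell>\<^sup>2(nat \<Rightarrow> 2)\<close> is not separable,
  but the algebra does not depend on the choice of a faithful representation.)\<close>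

definition tensor_power :: "nat \<Rightarrow> car_operator set" where
  "tensor_power n = span (range (\<lambda>a. elementary_tensor a n))"

definition car_algebra :: "car_operator set" where
  "car_algebra = closure (\<Union>n. tensor_power n)"


section \<open>Unitary groups of operator algebras\<close>

definition is_adjoint :: "('i ell2 \<Rightarrow>\<^sub>L 'i ell2) \<Rightarrow> ('i ell2 \<Rightarrow>\<^sub>L 'i ell2) \<Rightarrow> bool" where
  "is_adjoint u v \<longleftrightarrow> (\<forall>x y. cinner (blinfun_apply u x) y = cinner x (blinfun_apply v y))"

definition unitaries :: "('i ell2 \<Rightarrow>\<^sub>L 'i ell2) set \<Rightarrow> ('i ell2 \<Rightarrow>\<^sub>L 'i ell2) set" where
  "unitaries A = {u \<in> A. \<exists>v\<in>A. is_adjoint u v \<and> u o\<^sub>L v = id_blinfun \<and> v o\<^sub>L u = id_blinfun}"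

definition unitary_group :: "('i ell2 \<Rightarrow>\<^sub>L 'i ell2) set \<Rightarrow> ('i ell2 \<Rightarrow>\<^sub>L 'i ell2) monoid" where
  "unitary_group A = \<lparr>carrier = unitaries A, mult = (o\<^sub>L), one = id_blinfun\<rparr>"

definition norm_topology :: "('i ell2 \<Rightarrow>\<^sub>L 'i ell2) set \<Rightarrow> ('i ell2 \<Rightarrow>\<^sub>L 'i ell2) topology" where
  "norm_topology A = top_of_set (unitaries A)"


section \<open>The unitary group of the CAR algebra is a topological group\<close>

lemma blinfun_compose_assoc: "(f o\<^sub>L g) o\<^sub>L h = f o\<^sub>L (g o\<^sub>L h)"
  by (rule blinfun_eqI) simp

lemma blinfun_compose_id [simp]: "f o\<^sub>L id_blinfun = f" "id_blinfun o\<^sub>L f = f"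
  by (auto intro: blinfun_eqI)

lemma site_apply: "ell2_apply (blinfun_apply (site k m) x) = site_fun k m (ell2_apply x)"
  by (simp add: site.rep_eq site_ell2.rep_eq)

lemma car_operator_eqI:
  assumes "\<And>x s. ell2_apply (blinfun_apply u x) s = ell2_apply (blinfun_apply v x) s"
  shows "u = (v :: car_operator)"
  using assms by (intro blinfun_eqI) (simp add: ell2_apply_inject[symmetric] fun_eq_iff)

lemma site_mult: "site k (a ** b) = site k a o\<^sub>L site k b"
  by (rule car_operator_eqI)
    (simp add: site_apply site_fun_def matrix_matrix_mult_def sum_2 distrib_left distrib_right mult.assoc)

lemma site_one: "site k (mat 1) = id_blinfun"
proof (rule car_operator_eqI)
  fix x :: "configuration ell2" and s :: configuration
  have "(\<Sum>b\<in>UNIV. (if s k = b then 1 else 0) * ell2_apply x (s(k := b))) =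
      (\<Sum>b\<in>UNIV. if s k = b then ell2_apply x (s(k := b)) else 0)"
    by (intro sum.cong) auto
  then show "ell2_apply (blinfun_apply (site k (mat 1)) x) s = ell2_apply (blinfun_apply id_blinfun x) s"
    by (simp add: site_apply site_fun_def mat_def)
qed

lemma site_commute:
  assumes "j \<noteq> k"
  shows "site j a o\<^sub>L site k b = site k b o\<^sub>L site j a"
proof (rule car_operator_eqI)
  fix x :: "configuration ell2" and s :: configuration
  have "s(j := c, k := d) = s(k := d, j := c)" for c d
    using assms by (rule fun_upd_twist)
  then show "ell2_apply (blinfun_apply (site j a o\<^sub>L site k b) x) s =
      ell2_apply (blinfun_apply (site k b o\<^sub>L site j a) x) s"
    using assms by (simp add: site_apply site_fun_def sum_2 algebra_simps)
qed

lemma elementary_tensor_commute: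
  "n \<le> k \<Longrightarrow> site k m o\<^sub>L elementary_tensor a n = elementary_tensor a n o\<^sub>L site k m"
proof (induction n)
  case (Suc n)
  have IH: "site k m o\<^sub>L elementary_tensor a n = elementary_tensor a n o\<^sub>L site k m"
    using Suc by simp
  have "n \<noteq> k" using Suc.prems by simp
  have "site k m o\<^sub>L elementary_tensor a (Suc n) =
      (site k m o\<^sub>L elementary_tensor a n) o\<^sub>L site n (a n)"
    by (simp only: elementary_tensor.simps blinfun_compose_assoc)
  also have "\<dots> = elementary_tensor a n o\<^sub>L (site n (a n) o\<^sub>L site k m)"
    by (simp only: IH blinfun_compose_assoc site_commute[OF \<open>n \<noteq> k\<close>])
  also have "\<dots> = elementary_tensor a (Suc n) o\<^sub>L site k m"
    by (simp only: elementary_tensor.simps blinfun_compose_assoc)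
  finally show ?case .
qed simp

lemma elementary_tensor_mult:
  "elementary_tensor a n o\<^sub>L elementary_tensor b n = elementary_tensor (\<lambda>k. a k ** b k) n"
proof (induction n)
  case (Suc n)
  have "elementary_tensor a (Suc n) o\<^sub>L elementary_tensor b (Suc n) =
      elementary_tensor a n o\<^sub>L (site n (a n) o\<^sub>L elementary_tensor b n) o\<^sub>L site n (b n)"
    by (simp only: elementary_tensor.simps blinfun_compose_assoc)
  also have "\<dots> = (elementary_tensor a n o\<^sub>L elementary_tensor b n) o\<^sub>L (site n (a n) o\<^sub>L site n (b n))"
    by (simp only: elementary_tensor_commute[OF order_refl] blinfun_compose_assoc)
  finally show ?case
    by (simp only: Suc site_mult elementary_tensor.simps)
qed simp

lemma id_in_tensor_power: "id_blinfun \<in> tensor_power n"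
proof -
  have "elementary_tensor (\<lambda>_. mat 1) n = id_blinfun"
    by (induction n) (simp_all add: site_one)
  then show ?thesis
    unfolding tensor_power_def by (metis rangeI span_base)
qed

lemma tensor_power_mult:
  assumes "x \<in> tensor_power n" "y \<in> tensor_power n"
  shows "x o\<^sub>L y \<in> tensor_power n"
proof -
  let ?R = "range (\<lambda>a. elementary_tensor a n)"
  interpret bounded_bilinear "(o\<^sub>L) :: car_operator \<Rightarrow> car_operator \<Rightarrow> car_operator"
    by (rule bounded_bilinear_blinfun_compose)
  have 1: "elementary_tensor a n o\<^sub>L y \<in> span ?R" if "y \<in> span ?R" for a y
    using that
  proof (induction rule: span_induct_alt)
    case (step c u z)
    then have "elementary_tensor a n o\<^sub>L u \<in> span ?R"
      by (auto simp: elementary_tensor_mult intro: span_base)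
    then show ?case
      using step by (simp add: add_right scaleR_right span_add span_scale)
  qed (simp add: zero_right span_zero)
  have "x \<in> span ?R \<Longrightarrow> x o\<^sub>L y \<in> span ?R"
  proof (induction rule: span_induct_alt)
    case (step c u z)
    then show ?case
      using 1[of y] assms(2) unfolding tensor_power_def
      by (auto simp: add_left scaleR_left intro!: span_add span_scale)
  qed (simp add: zero_left span_zero)
  then show ?thesis
    using assms(1) by (simp add: tensor_power_def)
qed

lemma tensor_power_mono:
  assumes "m \<le> n"
  shows "tensor_power m \<subseteq> tensor_power n"
  using assms
proof (induction rule: dec_induct)
  case (step n)
  have "elementary_tensor a n \<in> tensor_power (Suc n)" for a
  proof -
    have "elementary_tensor (a(n := mat 1)) k = elementary_tensor a k" if "k \<le> n" for k
      using that by (induction k) auto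
    then have "elementary_tensor (a(n := mat 1)) (Suc n) = elementary_tensor a n"
      by (simp add: site_one)
    then show ?thesis
      unfolding tensor_power_def by (metis rangeI span_base)
  qed
  then have "tensor_power n \<subseteq> tensor_power (Suc n)"
    unfolding tensor_power_def[of n]
    by (intro span_minimal) (auto simp: tensor_power_def)
  then show ?case using step by blast
qed simp

lemma id_in_car_algebra: "id_blinfun \<in> car_algebra"
  unfolding car_algebra_def by (intro subsetD[OF closure_subset] UN_I[of 0] UNIV_I id_in_tensor_power)

lemma car_algebra_mult:
  assumes "x \<in> car_algebra" "y \<in> car_algebra"
  shows "x o\<^sub>L y \<in> car_algebra"
proof -
  let ?U = "\<Union>n. tensor_power n"
  have "(\<lambda>(x, y). x o\<^sub>L y) ` closure (?U \<times> ?U) \<subseteq> closure ?U"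
  proof (rule image_closure_subset)
    show "continuous_on (closure (?U \<times> ?U)) (\<lambda>(x, y). x o\<^sub>L y)"
      unfolding case_prod_unfold
      by (intro bounded_bilinear.continuous_on[OF bounded_bilinear_blinfun_compose] continuous_intros)
    have "x o\<^sub>L y \<in> ?U" if "x \<in> tensor_power m" "y \<in> tensor_power n" for x y m n
      using that tensor_power_mono[of m "max m n"] tensor_power_mono[of n "max m n"]
        tensor_power_mult[of x "max m n" y] by auto
    then show "(\<lambda>(x, y). x o\<^sub>L y) ` (?U \<times> ?U) \<subseteq> closure ?U"
      using closure_subset[of ?U] by fastforce
  qed simp
  then show ?thesis
    using assms unfolding car_algebra_def closure_Times by blast
qed

lemma is_adjoint_sym: "is_adjoint u v \<Longrightarrow> is_adjoint v u"
  unfolding is_adjoint_def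
proof (intro allI)
  fix x y
  assume "\<forall>x y. cinner (blinfun_apply u x) y = cinner x (blinfun_apply v y)"
  then have "cinner (blinfun_apply u y) x = cinner y (blinfun_apply v x)" by blast
  then show "cinner (blinfun_apply v x) y = cinner x (blinfun_apply u y)"
    by (simp only: cinner_commute[of x] cinner_commute[of _ y])
qed

lemma norm_unitary_le:
  assumes "u \<in> unitaries A"
  shows "norm u \<le> 1"
proof (rule norm_blinfun_bound)
  fix x
  obtain v where "is_adjoint u v" "v o\<^sub>L u = id_blinfun"
    using assms unfolding unitaries_def by blast
  then have "cinner (blinfun_apply u x) (blinfun_apply u x) = cinner x x"
    unfolding is_adjoint_def by (metis blinfun_apply_blinfun_compose blinfun_apply_id_blinfun)
  then show "norm (blinfun_apply u x) \<le> 1 * norm x"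
    by (simp add: norm_eq_sqrt_inner inner_ell2_def)
qed simp

lemma group_unitary_group:
  assumes "id_blinfun \<in> A" "\<And>x y. x \<in> A \<Longrightarrow> y \<in> A \<Longrightarrow> x o\<^sub>L y \<in> A"
  shows "group (unitary_group A)"
proof (rule groupI)
  fix x y assume "x \<in> carrier (unitary_group A)" "y \<in> carrier (unitary_group A)"
  then obtain x' y' where *: "x \<in> A" "x' \<in> A" "is_adjoint x x'" "x o\<^sub>L x' = id_blinfun"
      "x' o\<^sub>L x = id_blinfun" "y \<in> A" "y' \<in> A" "is_adjoint y y'" "y o\<^sub>L y' = id_blinfun"
      "y' o\<^sub>L y = id_blinfun"
    by (auto simp: unitary_group_def unitaries_def)
  have "(x o\<^sub>L y) o\<^sub>L (y' o\<^sub>L x') = id_blinfun" "(y' o\<^sub>L x') o\<^sub>L (x o\<^sub>L y) = id_blinfun"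
    using * by (metis blinfun_compose_assoc blinfun_compose_id(1))+
  moreover have "is_adjoint (x o\<^sub>L y) (y' o\<^sub>L x')"
    using * by (simp add: is_adjoint_def)
  ultimately show "x \<otimes>\<^bsub>unitary_group A\<^esub> y \<in> carrier (unitary_group A)"
    using * assms(2) by (auto simp: unitary_group_def unitaries_def)
next
  fix x assume "x \<in> carrier (unitary_group A)"
  then show "\<exists>y\<in>carrier (unitary_group A). y \<otimes>\<^bsub>unitary_group A\<^esub> x = \<one>\<^bsub>unitary_group A\<^esub>"
    by (auto simp: unitary_group_def unitaries_def dest: is_adjoint_sym)
next
  have "is_adjoint id_blinfun id_blinfun" by (simp add: is_adjoint_def)
  then show "\<one>\<^bsub>unitary_group A\<^esub> \<in> carrier (unitary_group A)"
    using assms(1) by (auto simp: unitary_group_def unitaries_def)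
qed (simp_all add: unitary_group_def blinfun_compose_assoc)

lemma topological_group_unitary_group:
  assumes "id_blinfun \<in> A" "\<And>x y. x \<in> A \<Longrightarrow> y \<in> A \<Longrightarrow> x o\<^sub>L y \<in> A"
  shows "topological_group (unitary_group A) (norm_topology A)"
proof -
  interpret group "unitary_group A"
    using assms by (rule group_unitary_group)
  let ?i = "\<lambda>x. inv\<^bsub>unitary_group A\<^esub> x"
  have mult: "x o\<^sub>L y \<in> unitaries A" if "x \<in> unitaries A" "y \<in> unitaries A" for x y
    using m_closed[of x y] that by (simp add: unitary_group_def)
  have inv: "?i x \<in> unitaries A" "?i x o\<^sub>L x = id_blinfun" "x o\<^sub>L ?i x = id_blinfun"
    if "x \<in> unitaries A" for x
    using inv_closed[of x] l_inv[of x] r_inv[of x] that by (simp_all add: unitary_group_def)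
  have lip: "dist (?i x) (?i y) \<le> dist x y" if "x \<in> unitaries A" "y \<in> unitaries A" for x y
  proof -
    have "?i x - ?i y = (?i x o\<^sub>L (y - x)) o\<^sub>L ?i y"
      using inv[OF that(1)] inv[OF that(2)]
      by (simp add: bounded_bilinear.diff_left[OF bounded_bilinear_blinfun_compose]
          bounded_bilinear.diff_right[OF bounded_bilinear_blinfun_compose] blinfun_compose_assoc)
    then have "norm (?i x - ?i y) \<le> norm (?i x o\<^sub>L (y - x)) * norm (?i y)"
      by (simp add: norm_blinfun_compose)
    also have "\<dots> \<le> (norm (?i x) * norm (y - x)) * norm (?i y)"
      by (intro mult_right_mono norm_blinfun_compose) simp
    also have "\<dots> \<le> (1 * norm (y - x)) * 1"
      using that by (intro mult_mono norm_unitary_le[of _ A] inv) auto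
    finally show ?thesis
      by (simp add: dist_norm norm_minus_commute)
  qed
  have "continuous_on (unitaries A) ?i"
    unfolding continuous_on_iff using lip by (meson le_less_trans)
  moreover have "continuous_on (unitaries A \<times> unitaries A) (\<lambda>(x, y). x o\<^sub>L y)"
    unfolding case_prod_unfold
    by (intro bounded_bilinear.continuous_on[OF bounded_bilinear_blinfun_compose] continuous_intros)
  ultimately have
    "continuous_map (top_of_set (unitaries A \<times> unitaries A)) (top_of_set (unitaries A)) (\<lambda>(x, y). x o\<^sub>L y)"
    "continuous_map (top_of_set (unitaries A)) (top_of_set (unitaries A)) ?i"
    using mult inv(1) by (auto simp: continuous_map_in_subtopology)
  moreover have "(\<lambda>(x, y). x \<otimes>\<^bsub>unitary_group A\<^esub> y) = (\<lambda>(x, y). x o\<^sub>L y)"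
    "carrier (unitary_group A) = unitaries A"
    by (simp_all add: unitary_group_def)
  ultimately show ?thesis
    using group_axioms by (simp add: topological_group_def norm_topology_def)
qed

lemma topological_group_car:
  "topological_group (unitary_group car_algebra) (norm_topology car_algebra)"
  by (rule topological_group_unitary_group) (simp_all add: id_in_car_algebra car_algebra_mult)

end

theory Submission
  imports Defs
begin

text \<open>
  Let \<open>K\<close> be the space of square-summable functions on configurations, on which the CAR
  algebra acts. The unitary group acts on the Hilbert-Schmidt operators of \<open>K\<close> by conjugation,
  \<open>T \<mapsto> u T u\<^sup>*\<close>, and this one representation violates property (T).

  No invariant vectors (\<open>conj_action_invariant_zero\<close>): the unitary that flips bit \<open>k\<close> moves the
  matrix entry of \<open>T\<close> at \<open>(t, s)\<close> to the pair of flipped configurations. If \<open>T\<close> is invariant,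
  its entry at \<open>(t, s)\<close> therefore recurs at infinitely many places, and square summability
  forces it to be zero.

  Almost invariant vectors (\<open>conj_action_almost_invariant\<close>): let \<open>P\<^sub>n\<close> be the projection onto the
  finitely many configurations that equal 1 from position \<open>n\<close> on. It commutes with
  the \<open>n\<close>-th tensor power of the matrix algebra. A norm-compact set of unitaries lies within any
  given \<open>\<delta>\<close> of a single tensor power, and if both \<open>u\<close> and \<open>u\<^sup>*\<close> do, then the Hilbert-Schmidt
  norm of \<open>u P\<^sub>n u\<^sup>* - P\<^sub>n\<close> is at most \<open>2 \<delta>\<close> times that of \<open>P\<^sub>n\<close> (\<open>conj_action_diag_proj\<close>).
  The norm of \<open>P\<^sub>n\<close> grows with \<open>n\<close>, but only the ratio matters.

  Hilbert-Schmidt operators are represented by their square-summable matrices. The lemma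
  \<open>not_property_T_ell2\<close> moves the representation to a Hilbert space of the type over which the
  definition of property (T) quantifies.
\<close>

section \<open>Square-summable functions form a complex Hilbert space\<close>

lemma ell2_eqI: "(\<And>i. ell2_apply x i = ell2_apply y i) \<Longrightarrow> x = y"
  by (simp add: ell2_apply_inject[symmetric] fun_eq_iff)

lemma ell2_apply_simps [simp]:
  "ell2_apply 0 i = 0"
  "ell2_apply (x + y) i = ell2_apply x i + ell2_apply y i"
  "ell2_apply (- x) i = - ell2_apply x i"
  "ell2_apply (x - y) i = ell2_apply x i - ell2_apply y i"
  by (simp_all only: zero_ell2.rep_eq plus_ell2.rep_eq uminus_ell2.rep_eq minus_ell2_def
      diff_conv_add_uminus)

lift_definition scaleC :: "complex \<Rightarrow> 'i ell2 \<Rightarrow> 'i ell2" is "\<lambda>c f i. c * f i"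
  by (rule square_summable_mult)

lemma ell2_apply_scaleC [simp]: "ell2_apply (scaleC c x) i = c * ell2_apply x i"
  by (simp add: scaleC.rep_eq)

lemma ell2_apply_scaleR [simp]: "ell2_apply (r *\<^sub>R x) i = of_real r * ell2_apply x i"
  by (simp add: scaleR_ell2.rep_eq)

lemma cinner_add_right: "cinner x (y + z) = cinner x y + cinner x z"
proof transfer
  fix f g h :: "'a \<Rightarrow> complex"
  assume "square_summable f" "square_summable g" "square_summable h"
  then show "(\<Sum>\<^sub>\<infinity>i. cnj (f i) * (g i + h i)) =
      (\<Sum>\<^sub>\<infinity>i. cnj (f i) * g i) + (\<Sum>\<^sub>\<infinity>i. cnj (f i) * h i)"
    by (simp add: square_summable_inner distrib_left flip: infsum_add)
qed

lemma cinner_scaleC_right: "cinner x (scaleC c y) = c * cinner x y"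
  unfolding cinner.rep_eq scaleC.rep_eq by (simp only: mult.left_commute[of _ c] infsum_cmult_right')

lemma cinner_self_norm: "cinner x x = of_real ((norm x)\<^sup>2)"
  by (simp add: cinner_self power2_norm_ell2)

lift_definition ket :: "'i \<Rightarrow> 'i ell2" is "\<lambda>i j. if j = i then 1 else 0"
proof -
  fix i :: 'i
  have "(\<lambda>j. (cmod (if j = i then 1 else 0))\<^sup>2) summable_on UNIV"
    by (rule finite_nonzero_values_imp_summable_on) (auto intro: finite_subset[of _ "{i}"])
  then show "square_summable (\<lambda>j. if j = i then 1 else 0)"
    by (simp add: square_summable_def)
qed

lemma ket_apply [simp]: "ell2_apply (ket i) j = (if j = i then 1 else 0)"
  by (simp add: ket.rep_eq)

lemma cinner_ket: "cinner (ket i) x = ell2_apply x i"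
proof -
  have "(\<Sum>\<^sub>\<infinity>j. cnj (ell2_apply (ket i) j) * ell2_apply x j) = (\<Sum>\<^sub>\<infinity>j\<in>{i}. ell2_apply x j)"
    by (rule infsum_cong_neutral) auto
  then show ?thesis
    by (simp add: cinner.rep_eq)
qed

lemma cmod_ell2_apply_le: "cmod (ell2_apply x i) \<le> norm x"
proof -
  have "(cmod (ell2_apply x i))\<^sup>2 \<le> (norm x)\<^sup>2"
    unfolding power2_norm_ell2
    using finite_sum_le_infsum[OF summable_ell2[of x], of "{i}"] by simp
  then show ?thesis
    by (simp add: power2_le_iff_abs_le)
qed

lemma square_summable_boundedI:
  assumes "\<And>F. finite F \<Longrightarrow> (\<Sum>i\<in>F. (cmod (f i))\<^sup>2) \<le> C"
  shows "square_summable f"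
  unfolding square_summable_def
  by (rule nonneg_bdd_above_summable_on) (auto intro!: bdd_aboveI2 assms)

lemma norm_ell2_boundedI:
  assumes "\<And>F. finite F \<Longrightarrow> (\<Sum>i\<in>F. (cmod (ell2_apply x i))\<^sup>2) \<le> C\<^sup>2" "0 \<le> C"
  shows "norm x \<le> C"
proof -
  have "(norm x)\<^sup>2 \<le> C\<^sup>2"
    unfolding power2_norm_ell2 by (intro infsum_le_finite_sums summable_ell2 assms) auto
  then show ?thesis
    using assms(2) by (rule power2_le_imp_le)
qed

instance ell2 :: (type) complete_space
proof
  fix S :: "nat \<Rightarrow> 'a ell2"
  assume S: "Cauchy S"
  have "Cauchy (\<lambda>n. ell2_apply (S n) i)" for i
    unfolding Cauchy_def
  proof (intro allI impI)
    fix e :: real assume "0 < e"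
    then obtain N where N: "\<And>m n. m \<ge> N \<Longrightarrow> n \<ge> N \<Longrightarrow> dist (S m) (S n) < e"
      using S unfolding Cauchy_def by blast
    have "dist (ell2_apply (S m) i) (ell2_apply (S n) i) < e" if "m \<ge> N" "n \<ge> N" for m n
      using cmod_ell2_apply_le[of "S m - S n" i] N[OF that] by (simp add: dist_norm)
    then show "\<exists>M. \<forall>m\<ge>M. \<forall>n\<ge>M. dist (ell2_apply (S m) i) (ell2_apply (S n) i) < e"
      by blast
  qed
  then have "\<forall>i. \<exists>l. (\<lambda>n. ell2_apply (S n) i) \<longlonglongrightarrow> l"
    by (simp add: Cauchy_convergent_iff convergent_def)
  then obtain f where f: "\<And>i. (\<lambda>n. ell2_apply (S n) i) \<longlonglongrightarrow> f i"
    by metis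
  \<comment> \<open>The Cauchy bound on finite partial sums survives the coordinatewise limit.\<close>
  have tail: "\<exists>N. \<forall>m\<ge>N. \<forall>F. finite F \<longrightarrow> (\<Sum>i\<in>F. (cmod (ell2_apply (S m) i - f i))\<^sup>2) \<le> e\<^sup>2"
    if "0 < e" for e :: real
  proof -
    obtain N where N: "\<And>m n. m \<ge> N \<Longrightarrow> n \<ge> N \<Longrightarrow> dist (S m) (S n) < e"
      using S \<open>0 < e\<close> unfolding Cauchy_def by blast
    have "(\<Sum>i\<in>F. (cmod (ell2_apply (S m) i - f i))\<^sup>2) \<le> e\<^sup>2" if "m \<ge> N" "finite F" for m F
    proof (rule LIMSEQ_le_const2)
      show "(\<lambda>n. \<Sum>i\<in>F. (cmod (ell2_apply (S m) i - ell2_apply (S n) i))\<^sup>2)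
          \<longlonglongrightarrow> (\<Sum>i\<in>F. (cmod (ell2_apply (S m) i - f i))\<^sup>2)"
        by (intro tendsto_intros f)
      have "(\<Sum>i\<in>F. (cmod (ell2_apply (S m) i - ell2_apply (S n) i))\<^sup>2) \<le> e\<^sup>2" if "n \<ge> N" for n
      proof -
        have "(\<Sum>i\<in>F. (cmod (ell2_apply (S m) i - ell2_apply (S n) i))\<^sup>2) \<le> (norm (S m - S n))\<^sup>2"
          unfolding power2_norm_ell2
          using finite_sum_le_infsum[OF summable_ell2[of "S m - S n"] \<open>finite F\<close>] by simp
        also have "\<dots> \<le> e\<^sup>2"
          using N[OF \<open>m \<ge> N\<close> that] by (intro power_mono) (auto simp: dist_norm)
        finally show ?thesis .
      qed
      then show "\<exists>N. \<forall>n\<ge>N. (\<Sum>i\<in>F. (cmod (ell2_apply (S m) i - ell2_apply (S n) i))\<^sup>2) \<le> e\<^sup>2"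
        by blast
    qed
    then show ?thesis by blast
  qed
  have "square_summable f"
  proof -
    obtain N where "\<And>F. finite F \<Longrightarrow> (\<Sum>i\<in>F. (cmod (ell2_apply (S N) i - f i))\<^sup>2) \<le> 1\<^sup>2"
      using tail[of 1] by auto
    then have "square_summable (\<lambda>i. ell2_apply (S N) i - f i)"
      by (rule square_summable_boundedI)
    then have "square_summable (\<lambda>i. ell2_apply (S N) i + (-1) * (ell2_apply (S N) i - f i))"
      using ell2_apply[of "S N"] by (intro square_summable_add square_summable_mult) simp_all
    then show ?thesis by simp
  qed
  then have x: "ell2_apply (Abs_ell2 f) = f"
    by (simp add: Abs_ell2_inverse)
  have "S \<longlonglongrightarrow> Abs_ell2 f"
  proof (rule metric_LIMSEQ_I)
    fix e :: real assume "0 < e"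
    then obtain N where N: "\<And>m F. m \<ge> N \<Longrightarrow> finite F
        \<Longrightarrow> (\<Sum>i\<in>F. (cmod (ell2_apply (S m) i - f i))\<^sup>2) \<le> (e / 2)\<^sup>2"
      using tail[of "e / 2"] by auto
    have "norm (S m - Abs_ell2 f) < e" if "m \<ge> N" for m
    proof -
      have "norm (S m - Abs_ell2 f) \<le> e / 2"
        using \<open>0 < e\<close> N[OF that] by (intro norm_ell2_boundedI) (simp_all add: x)
      then show ?thesis using \<open>0 < e\<close> by simp
    qed
    then show "\<exists>N. \<forall>n\<ge>N. dist (S n) (Abs_ell2 f) < e"
      unfolding dist_norm by blast
  qed
  then show "convergent S"
    by (auto simp: convergent_def)
qed


section \<open>A criterion for the failure of property (T)\<close>

text \<open>Composition with a surjection \<open>g\<close> from \<open>'x\<close> to \<open>'i\<close> embeds the square-summable functions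
  on \<open>'i\<close> into the arbitrary functions on \<open>'x\<close>. The operations of \<open>pullback_space\<close> are
  transported along this embedding, so that every space \<open>'i ell2\<close> acquires a copy whose carrier
  has a prescribed function type.\<close>

definition pullback :: "('x \<Rightarrow> 'i) \<Rightarrow> 'i ell2 \<Rightarrow> 'x \<Rightarrow> complex" where
  "pullback g x = ell2_apply x \<circ> g"

definition pullback_space :: "('x \<Rightarrow> 'i) \<Rightarrow> ('x \<Rightarrow> complex) hilbert" where
  "pullback_space g = \<lparr>carrier = range (pullback g), mult = undefined, one = undefined,
     zero = pullback g 0,
     add = \<lambda>a b. pullback g (inv_into UNIV (pullback g) a + inv_into UNIV (pullback g) b),
     smult = \<lambda>c a. pullback g (scaleC c (inv_into UNIV (pullback g) a)),
     hinner = \<lambda>a b. cinner (inv_into UNIV (pullback g) a) (inv_into UNIV (pullback g) b)\<rparr>"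

context
  fixes g :: "'x \<Rightarrow> 'i"
  assumes surj: "surj g"
begin

lemma inj_pullback: "inj (pullback g)"
proof (rule injI, rule ell2_eqI)
  fix x y i
  assume *: "pullback g x = pullback g y"
  obtain a where "i = g a" using surj by blast
  then show "ell2_apply x i = ell2_apply y i"
    using fun_cong[OF *, of a] by (simp add: pullback_def)
qed

lemma pullback_space_simps:
  "carrier (pullback_space g) = range (pullback g)"
  "\<zero>\<^bsub>pullback_space g\<^esub> = pullback g 0"
  "pullback g x \<oplus>\<^bsub>pullback_space g\<^esub> pullback g y = pullback g (x + y)"
  "c \<odot>\<^bsub>pullback_space g\<^esub> pullback g x = pullback g (scaleC c x)"
  "hinner (pullback_space g) (pullback g x) (pullback g y) = cinner x y"
  by (simp_all add: pullback_space_def inj_pullback)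

lemma module_pullback_space:
  "Module.module (ring_of_type_algebra :: complex ring) (pullback_space g)"
proof (rule moduleI)
  show "cring (ring_of_type_algebra :: complex ring)"
    by (rule cring_from_type_algebra)
  show "abelian_group (pullback_space g)"
  proof (rule abelian_groupI)
    fix a assume "a \<in> carrier (pullback_space g)"
    then obtain x where "a = pullback g x"
      by (auto simp: pullback_space_simps)
    then have "pullback g (- x) \<oplus>\<^bsub>pullback_space g\<^esub> a = \<zero>\<^bsub>pullback_space g\<^esub>"
      by (simp add: pullback_space_simps)
    then show "\<exists>b\<in>carrier (pullback_space g). b \<oplus>\<^bsub>pullback_space g\<^esub> a = \<zero>\<^bsub>pullback_space g\<^esub>"
      by (auto simp: pullback_space_simps)
  qed (auto simp: pullback_space_simps algebra_simps)
  have "scaleC (c + d) x = scaleC c x + scaleC d x" "scaleC c (x + y) = scaleC c x + scaleC c y"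
    "scaleC (c * d) x = scaleC c (scaleC d x)" "scaleC 1 x = x" for c d and x y :: "'i ell2"
    by (auto intro!: ell2_eqI simp: algebra_simps)
  then show
    "\<And>a b x. \<lbrakk>a \<in> carrier ring_of_type_algebra; b \<in> carrier ring_of_type_algebra; x \<in> carrier (pullback_space g)\<rbrakk>
      \<Longrightarrow> (a \<oplus>\<^bsub>ring_of_type_algebra\<^esub> b) \<odot>\<^bsub>pullback_space g\<^esub> x = a \<odot>\<^bsub>pullback_space g\<^esub> x \<oplus>\<^bsub>pullback_space g\<^esub> b \<odot>\<^bsub>pullback_space g\<^esub> x"
    "\<And>a x y. \<lbrakk>a \<in> carrier ring_of_type_algebra; x \<in> carrier (pullback_space g); y \<in> carrier (pullback_space g)\<rbrakk>
      \<Longrightarrow> a \<odot>\<^bsub>pullback_space g\<^esub> (x \<oplus>\<^bsub>pullback_space g\<^esub> y) = a \<odot>\<^bsub>pullback_space g\<^esub> x \<oplus>\<^bsub>pullback_space g\<^esub> a \<odot>\<^bsub>pullback_space g\<^esub> y"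
    "\<And>a b x. \<lbrakk>a \<in> carrier ring_of_type_algebra; b \<in> carrier ring_of_type_algebra; x \<in> carrier (pullback_space g)\<rbrakk>
      \<Longrightarrow> (a \<otimes>\<^bsub>ring_of_type_algebra\<^esub> b) \<odot>\<^bsub>pullback_space g\<^esub> x = a \<odot>\<^bsub>pullback_space g\<^esub> (b \<odot>\<^bsub>pullback_space g\<^esub> x)"
    "\<And>x. x \<in> carrier (pullback_space g) \<Longrightarrow> \<one>\<^bsub>ring_of_type_algebra\<^esub> \<odot>\<^bsub>pullback_space g\<^esub> x = x"
    by (auto simp: pullback_space_simps ring_of_type_algebra_def)
qed (auto simp: pullback_space_simps)

text \<open>The operations decode arbitrary functions, so subtraction is given by the same formula
  off the carrier. This makes the distance symmetric everywhere, as the metric space locale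
  demands.\<close>

lemma pullback_space_minus_decode:
  "a \<ominus>\<^bsub>pullback_space g\<^esub> b =
    pullback g (inv_into UNIV (pullback g) a - inv_into UNIV (pullback g) b)"
proof -
  let ?d = "inv_into UNIV (pullback g)"
  have "\<ominus>\<^bsub>pullback_space g\<^esub> b = pullback g (- ?d b)"
    unfolding a_inv_def m_inv_def
  proof (rule the_equality)
    fix y
    assume "y \<in> carrier (add_monoid (pullback_space g)) \<and>
      b \<otimes>\<^bsub>add_monoid (pullback_space g)\<^esub> y = \<one>\<^bsub>add_monoid (pullback_space g)\<^esub> \<and>
      y \<otimes>\<^bsub>add_monoid (pullback_space g)\<^esub> b = \<one>\<^bsub>add_monoid (pullback_space g)\<^esub>"
    then obtain z where "y = pullback g z" "z + ?d b = 0"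
      by (auto simp: pullback_space_def inj_pullback inj_pullback[THEN inj_eq])
    then show "y = pullback g (- ?d b)"
      by (metis eq_neg_iff_add_eq_0)
  qed (simp add: pullback_space_def inj_pullback)
  then show ?thesis
    by (simp add: a_minus_def pullback_space_def inj_pullback)
qed

lemma pullback_space_minus:
  "pullback g x \<ominus>\<^bsub>pullback_space g\<^esub> pullback g y = pullback g (x - y)"
  by (simp add: pullback_space_minus_decode inj_pullback)

lemma hnorm_pullback_space: "hnorm (pullback_space g) (pullback g x) = norm x"
  by (simp add: hnorm_def pullback_space_simps cinner_self_norm)

lemma hdist_pullback_space: "hdist (pullback_space g) (pullback g x) (pullback g y) = dist x y"
  by (simp add: hdist_def pullback_space_minus hnorm_pullback_space dist_norm)

lemma Metric_space_pullback_space: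
  "Metric_space (range (pullback g)) (hdist (pullback_space g))"
proof -
  let ?d = "inv_into UNIV (pullback g)"
  have "hdist (pullback_space g) a b = dist (?d a) (?d b)" for a b
    by (simp add: hdist_def pullback_space_minus_decode hnorm_pullback_space dist_norm)
  then show ?thesis
    by unfold_locales (auto simp: dist_commute dist_triangle inj_pullback)
qed

lemma limitin_pullback_space:
  assumes "\<sigma> \<longlonglongrightarrow> x"
  shows "limitin (Metric_space.mtopology (range (pullback g)) (hdist (pullback_space g)))
    (\<lambda>n. pullback g (\<sigma> n)) (pullback g x) sequentially"
  using assms
  by (auto simp: Metric_space.limit_metric_sequentially[OF Metric_space_pullback_space]
      hdist_pullback_space lim_sequentially)

lemma hilbert_space_pullback_space: "hilbert_space (pullback_space g)"
proof (intro hilbert_space.intro hilbert_space_axioms.intro module_pullback_space)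
  interpret Metric_space "range (pullback g)" "hdist (pullback_space g)"
    by (rule Metric_space_pullback_space)
  show "Metric_space.mcomplete (carrier (pullback_space g)) (hdist (pullback_space g))"
    unfolding pullback_space_simps mcomplete_def
  proof (intro allI impI)
    fix \<tau> assume \<tau>: "MCauchy \<tau>"
    define \<sigma> where "\<sigma> n = inv_into UNIV (pullback g) (\<tau> n)" for n
    have "\<tau> n \<in> range (pullback g)" for n
      using \<tau> by (auto simp: MCauchy_def)
    then have \<tau>_eq: "\<tau> = (\<lambda>n. pullback g (\<sigma> n))"
      by (simp add: \<sigma>_def f_inv_into_f)
    have "Cauchy \<sigma>"
      using \<tau> by (simp add: MCauchy_def Cauchy_def \<tau>_eq hdist_pullback_space)
    then obtain x where "\<sigma> \<longlonglongrightarrow> x"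
      by (auto simp: Cauchy_convergent_iff convergent_def)
    then show "\<exists>l. limitin mtopology \<tau> l sequentially"
      unfolding \<tau>_eq by (blast intro: limitin_pullback_space)
  qed
qed (auto simp: pullback_space_simps cinner_add_right cinner_scaleC_right cinner_self_norm
    intro: cinner_commute)

end

text \<open>A counterexample to property (T) may be given on square-summable functions over any index
  type that is small enough to be an image of the index type in \<^typ>\<open>'g rep_space\<close>. The remaining
  hypotheses are those on the representation, without carriers; the weak inequality for almost
  invariant vectors suffices because \<open>\<epsilon>\<close> can be halved.\<close>

lemma not_property_T_ell2:
  fixes G :: "('g, 'm) monoid_scheme" and \<rho> :: "'g \<Rightarrow> 'i ell2 \<Rightarrow> 'i ell2"
    and g :: "'g set \<times> nat \<times> 'g \<Rightarrow> 'i"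
  assumes g: "surj g"
    and mult: "\<And>x y. x \<in> carrier G \<Longrightarrow> y \<in> carrier G \<Longrightarrow> \<rho> (x \<otimes>\<^bsub>G\<^esub> y) = \<rho> x \<circ> \<rho> y"
    and bij: "\<And>x. x \<in> carrier G \<Longrightarrow> bij (\<rho> x)"
    and add: "\<And>x \<xi> \<eta>. x \<in> carrier G \<Longrightarrow> \<rho> x (\<xi> + \<eta>) = \<rho> x \<xi> + \<rho> x \<eta>"
    and scaleC: "\<And>x c \<xi>. x \<in> carrier G \<Longrightarrow> \<rho> x (scaleC c \<xi>) = scaleC c (\<rho> x \<xi>)"
    and cinner: "\<And>x \<xi> \<eta>. x \<in> carrier G \<Longrightarrow> cinner (\<rho> x \<xi>) (\<rho> x \<eta>) = cinner \<xi> \<eta>"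
    and continuous: "\<And>\<xi>. continuous_map T euclidean (\<lambda>x. \<rho> x \<xi>)"
    and almost_invariant: "\<And>Q \<epsilon>. compactin T Q \<Longrightarrow> 0 < \<epsilon>
      \<Longrightarrow> \<exists>\<xi>. \<xi> \<noteq> 0 \<and> (\<forall>x\<in>Q. norm (\<rho> x \<xi> - \<xi>) \<le> \<epsilon> * norm \<xi>)"
    and invariant: "\<And>\<xi>. (\<And>x. x \<in> carrier G \<Longrightarrow> \<rho> x \<xi> = \<xi>) \<Longrightarrow> \<xi> = 0"
  shows "\<not> property_T G T"
proof
  assume T: "property_T G T"
  define H where "H = pullback_space g"
  let ?\<Phi> = "pullback g"
  define R where "R x = restrict (\<lambda>a. ?\<Phi> (\<rho> x (inv_into UNIV ?\<Phi> a))) (range ?\<Phi>)" for x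
  note simps = pullback_space_simps[OF g, folded H_def]
  interpret Metric_space "range ?\<Phi>" "hdist H"
    unfolding H_def using g by (rule Metric_space_pullback_space)
  have R [simp]: "R x (?\<Phi> \<xi>) = ?\<Phi> (\<rho> x \<xi>)" for x \<xi>
    by (simp add: R_def inj_pullback[OF g])
  have R_Bij: "R x \<in> Bij (range ?\<Phi>)" if "x \<in> carrier G" for x
  proof -
    have "inj_on (R x) (range ?\<Phi>)"
      using bij[OF that] by (auto simp: inj_on_def inj_pullback[OF g, THEN inj_eq] bij_is_inj[THEN inj_eq])
    moreover have "R x ` range ?\<Phi> = range ?\<Phi>"
    proof -
      have "R x ` range ?\<Phi> = ?\<Phi> ` range (\<rho> x)"
        by (simp add: image_image)
      then show ?thesis using bij_is_surj[OF bij[OF that]] by simp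
    qed
    ultimately show ?thesis
      by (simp add: Bij_def bij_betw_def R_def)
  qed
  have "R \<in> hom G (hunitary H)"
  proof (rule homI)
    fix x assume "x \<in> carrier G"
    then show "R x \<in> carrier (hunitary H)"
      using R_Bij by (auto simp: hunitary_def simps add scaleC cinner)
  next
    fix x y assume xy: "x \<in> carrier G" "y \<in> carrier G"
    have "R (x \<otimes>\<^bsub>G\<^esub> y) = compose (range ?\<Phi>) (R x) (R y)"
    proof
      show "R (x \<otimes>\<^bsub>G\<^esub> y) a = compose (range ?\<Phi>) (R x) (R y) a" for a
        by (cases "a \<in> range ?\<Phi>") (auto simp: compose_def R_def mult[OF xy] inj_pullback[OF g])
    qed
    then show "R (x \<otimes>\<^bsub>G\<^esub> y) = R x \<otimes>\<^bsub>hunitary H\<^esub> R y"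
      using R_Bij xy by (simp add: hunitary_def BijGroup_def simps)
  qed
  moreover have "continuous_map T mtopology (\<lambda>x. R x a)" if "a \<in> carrier H" for a
  proof -
    obtain \<xi> where \<xi>: "a = ?\<Phi> \<xi>" using \<open>a \<in> carrier H\<close> by (auto simp: simps)
    have "\<exists>U. openin T U \<and> x \<in> U \<and> (\<forall>y\<in>U. dist (\<rho> x \<xi>) (\<rho> y \<xi>) < \<epsilon>)"
      if "x \<in> topspace T" "0 < \<epsilon>" for x \<epsilon>
      using that continuous[of \<xi>, folded mtopology_is_euclidean]
      unfolding Met_TC.continuous_map_to_metric by (auto simp: Met_TC.in_mball)
    then show ?thesis
      unfolding continuous_map_to_metric \<xi>
      by (simp add: hdist_pullback_space[OF g, folded H_def])
  qed
  ultimately have "unitary_rep G T H R"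
    by (simp add: unitary_rep_def simps)
  moreover have "almost_has_invariant_vectors T H R"
    unfolding almost_has_invariant_vectors_def
  proof (intro allI impI)
    fix Q and \<epsilon> :: real assume Q: "compactin T Q \<and> Q \<noteq> {} \<and> 0 < \<epsilon>"
    then obtain \<xi> where \<xi>: "\<xi> \<noteq> 0" "\<And>x. x \<in> Q \<Longrightarrow> norm (\<rho> x \<xi> - \<xi>) \<le> \<epsilon> / 2 * norm \<xi>"
      using almost_invariant[of Q "\<epsilon> / 2"] by auto
    have "(SUP x\<in>Q. norm (\<rho> x \<xi> - \<xi>)) \<le> \<epsilon> / 2 * norm \<xi>"
      using Q \<xi>(2) by (intro cSUP_least) auto
    also have "\<dots> < \<epsilon> * norm \<xi>"
      using Q \<xi>(1) by simp
    finally have "almost_invariant_vector H R Q \<epsilon> (?\<Phi> \<xi>)"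
      unfolding almost_invariant_vector_def
      by (simp add: simps pullback_space_minus[OF g, folded H_def] hnorm_pullback_space[OF g, folded H_def])
    then show "\<exists>a. almost_invariant_vector H R Q \<epsilon> a" by blast
  qed
  ultimately have "has_invariant_vector G H R"
    using T hilbert_space_pullback_space[OF g] unfolding property_T_def H_def by blast
  then obtain \<xi> where "?\<Phi> \<xi> \<noteq> ?\<Phi> 0" "\<And>x. x \<in> carrier G \<Longrightarrow> ?\<Phi> (\<rho> x \<xi>) = ?\<Phi> \<xi>"
    by (auto simp: has_invariant_vector_def simps)
  then show False
    using invariant by (metis inj_pullback[OF g, THEN injD])
qed

section \<open>Hilbert-Schmidt kernels\<close>

text \<open>A function \<open>T\<close> on pairs stands for the operator whose matrix entry from \<open>t\<close> to \<open>s\<close> is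
  \<open>T (t, s)\<close>. So \<open>row T t\<close> is the image of \<open>ket t\<close> under this operator, \<open>ampl u T\<close> below is the
  composition of \<open>u\<close> after \<open>T\<close>, and \<open>adj T\<close> is the adjoint operator.\<close>

lift_definition row :: "('j \<times> 'i) ell2 \<Rightarrow> 'j \<Rightarrow> 'i ell2" is "\<lambda>f t s. f (t, s)"
proof -
  fix f :: "'j \<times> 'i \<Rightarrow> complex" and t
  assume "square_summable f"
  then have "(\<lambda>p. (cmod (f p))\<^sup>2) summable_on range (Pair t)"
    unfolding square_summable_def by (rule summable_on_subset_banach) simp
  then show "square_summable (\<lambda>s. f (t, s))"
    by (simp add: square_summable_def summable_on_reindex inj_on_def o_def)
qed

lemma row_apply [simp]: "ell2_apply (row T t) s = ell2_apply T (t, s)"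
  by (simp add: row.rep_eq)

lemma row_eqI: "(\<And>t. row T t = row S t) \<Longrightarrow> T = S"
  by (rule ell2_eqI) (metis row_apply surj_pair)

lemma row_simps [simp]:
  "row (T + S) t = row T t + row S t"
  "row (T - S) t = row T t - row S t"
  "row (r *\<^sub>R T) t = r *\<^sub>R row T t"
  "row (scaleC c T) t = scaleC c (row T t)"
  by (auto intro: ell2_eqI)

lemma summable_kernel: "(\<lambda>(t, s). (cmod (ell2_apply T (t, s)))\<^sup>2) summable_on UNIV \<times> UNIV"
  using summable_ell2[of T] by (simp add: case_prod_unfold)

lemma power2_norm_rows:
  "(\<lambda>t. (norm (row T t))\<^sup>2) summable_on UNIV" "(norm T)\<^sup>2 = (\<Sum>\<^sub>\<infinity>t. (norm (row T t))\<^sup>2)"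
  using summable_on_Sigma_banach[OF summable_kernel[of T]]
    infsum_Sigma'_banach[OF summable_kernel[of T]]
  by (simp_all add: power2_norm_ell2 case_prod_unfold)

lemma cinner_rows: "cinner T S = (\<Sum>\<^sub>\<infinity>t. cinner (row T t) (row S t))"
proof -
  have "(\<lambda>(t, s). cnj (ell2_apply T (t, s)) * ell2_apply S (t, s)) summable_on UNIV \<times> UNIV"
    using square_summable_inner[of "ell2_apply T" "ell2_apply S"] ell2_apply[of T] ell2_apply[of S]
    by (simp add: case_prod_unfold)
  from infsum_Sigma'_banach[OF this] show ?thesis
    by (simp add: cinner.rep_eq case_prod_unfold)
qed

definition ampl :: "('i ell2 \<Rightarrow>\<^sub>L 'i ell2) \<Rightarrow> ('j \<times> 'i) ell2 \<Rightarrow> ('j \<times> 'i) ell2" where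
  "ampl u T = Abs_ell2 (\<lambda>(t, s). ell2_apply (blinfun_apply u (row T t)) s)"

lemma ampl_apply [simp]:
  "ell2_apply (ampl u T) (t, s) = ell2_apply (blinfun_apply u (row T t)) s"
proof -
  let ?f = "\<lambda>(t, s). ell2_apply (blinfun_apply u (row T t)) s"
  have "(\<lambda>p. (cmod (?f p))\<^sup>2) summable_on UNIV \<times> UNIV"
  proof (rule summable_on_SigmaI[where g = "\<lambda>t. (norm (blinfun_apply u (row T t)))\<^sup>2"])
    show "((\<lambda>s. (cmod (?f (t, s)))\<^sup>2) has_sum (norm (blinfun_apply u (row T t)))\<^sup>2) UNIV" for t
      using has_sum_infsum[OF summable_ell2] by (simp add: power2_norm_ell2)
    show "(\<lambda>t. (norm (blinfun_apply u (row T t)))\<^sup>2) summable_on UNIV"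
    proof (rule summable_on_comparison_test)
      show "(\<lambda>t. (norm u)\<^sup>2 * (norm (row T t))\<^sup>2) summable_on UNIV"
        by (intro summable_on_cmult_right power2_norm_rows)
      show "(norm (blinfun_apply u (row T t)))\<^sup>2 \<le> (norm u)\<^sup>2 * (norm (row T t))\<^sup>2" for t
        unfolding power_mult_distrib[symmetric] by (intro power_mono norm_blinfun) simp
    qed simp
  qed simp
  then have "square_summable ?f"
    by (simp add: square_summable_def)
  then show ?thesis
    by (simp add: ampl_def Abs_ell2_inverse)
qed

lemma row_ampl [simp]: "row (ampl u T) t = blinfun_apply u (row T t)"
  by (rule ell2_eqI) simp

lemma norm_ampl_le: "norm (ampl u T) \<le> norm u * norm T"
proof -
  have "(norm (ampl u T))\<^sup>2 \<le> (\<Sum>\<^sub>\<infinity>t. (norm u)\<^sup>2 * (norm (row T t))\<^sup>2)"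
    unfolding power2_norm_rows(2)[of "ampl u T"]
  proof (rule infsum_mono)
    show "(\<lambda>t. (norm u)\<^sup>2 * (norm (row T t))\<^sup>2) summable_on UNIV"
      by (intro summable_on_cmult_right power2_norm_rows)
    show "(norm (row (ampl u T) t))\<^sup>2 \<le> (norm u)\<^sup>2 * (norm (row T t))\<^sup>2" for t
      unfolding power_mult_distrib[symmetric] row_ampl by (intro power_mono norm_blinfun) simp
  qed (rule power2_norm_rows)
  also have "\<dots> = (norm u * norm T)\<^sup>2"
    by (simp add: infsum_cmult_right' power2_norm_rows(2)[of T] power_mult_distrib)
  finally show ?thesis
    by (rule power2_le_imp_le) simp
qed

lemma bounded_bilinear_ampl: "bounded_bilinear ampl"
proof
  show "ampl (u + v) T = ampl u T + ampl v T" "ampl u (T + S) = ampl u T + ampl u S"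
    "ampl (r *\<^sub>R u) T = r *\<^sub>R ampl u T" "ampl u (r *\<^sub>R T) = r *\<^sub>R ampl u T"
    for u v :: "'i ell2 \<Rightarrow>\<^sub>L 'i ell2" and T S :: "('j \<times> 'i) ell2" and r
    by (auto intro!: row_eqI simp: blinfun.bilinear_simps)
  show "\<exists>K. \<forall>u (T :: ('j \<times> 'i) ell2). norm (ampl u T) \<le> norm u * norm T * K"
    by (intro exI[of _ 1]) (simp add: norm_ampl_le)
qed

lemma ampl_compose: "ampl (u o\<^sub>L v) T = ampl u (ampl v T)"
  by (rule row_eqI) simp

lemma ampl_id [simp]: "ampl id_blinfun T = T"
  by (rule row_eqI) simp

lemma cinner_ampl: "is_adjoint u v \<Longrightarrow> cinner (ampl u T) S = cinner T (ampl v S)"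
  by (simp add: cinner_rows is_adjoint_def)

text \<open>The type of bounded operators only provides real linearity. Complex linearity comes from
  an adjoint with respect to the complex inner product.\<close>

lemma is_adjoint_scaleC:
  assumes "is_adjoint u v"
  shows "blinfun_apply u (scaleC c x) = scaleC c (blinfun_apply u x)"
proof (rule ell2_eqI)
  have u: "ell2_apply (blinfun_apply u x) i = cinner (blinfun_apply v (ket i)) x" for x i
    using is_adjoint_sym[OF assms] by (simp add: cinner_ket[symmetric] is_adjoint_def)
  show "ell2_apply (blinfun_apply u (scaleC c x)) i = ell2_apply (scaleC c (blinfun_apply u x)) i" for i
    by (simp add: u cinner_scaleC_right)
qed

lift_definition adj :: "('i \<times> 'i) ell2 \<Rightarrow> ('i \<times> 'i) ell2" is "\<lambda>f (t, s). cnj (f (s, t))"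
proof -
  fix f :: "'i \<times> 'i \<Rightarrow> complex"
  assume "square_summable f"
  then have "(\<lambda>p. (cmod (f (prod.swap p)))\<^sup>2) summable_on UNIV"
    using summable_on_reindex_bij_betw[of prod.swap UNIV UNIV "\<lambda>p. (cmod (f p))\<^sup>2"]
    by (simp add: square_summable_def)
  then show "square_summable (\<lambda>(t, s). cnj (f (s, t)))"
    by (simp add: square_summable_def case_prod_unfold prod.swap_def)
qed

lemma adj_apply [simp]: "ell2_apply (adj T) (t, s) = cnj (ell2_apply T (s, t))"
  by (simp add: adj.rep_eq)

lemma adj_simps [simp]:
  "adj (adj T) = T"
  "adj (T + S) = adj T + adj S"
  "adj (r *\<^sub>R T) = r *\<^sub>R adj T"
  "adj (scaleC c T) = scaleC (cnj c) (adj T)"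
  by (auto intro!: ell2_eqI simp: split_paired_all)

lemma cinner_adj: "cinner (adj T) S = cnj (cinner T (adj S))"
proof -
  have "cinner (adj T) S = (\<Sum>\<^sub>\<infinity>p. ell2_apply T (prod.swap p) * ell2_apply S p)"
    by (simp add: cinner.rep_eq case_prod_unfold adj.rep_eq prod.swap_def)
  also have "\<dots> = (\<Sum>\<^sub>\<infinity>p. ell2_apply T p * ell2_apply S (prod.swap p))"
    using infsum_reindex_bij_betw[of prod.swap UNIV UNIV "\<lambda>p. ell2_apply T p * ell2_apply S (prod.swap p)"]
    by simp
  also have "\<dots> = cnj (cinner T (adj S))"
    by (simp add: cinner.rep_eq case_prod_unfold adj.rep_eq prod.swap_def flip: infsum_cnj)
  finally show ?thesis .
qed

lemma norm_adj [simp]: "norm (adj T) = norm T"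
  by (simp add: norm_eq_sqrt_inner inner_ell2_def cinner_adj)

lemma bounded_linear_adj: "bounded_linear adj"
  by (rule bounded_linear_intro[of _ 1]) simp_all

text \<open>The map \<open>T \<mapsto> adj (ampl v (adj T))\<close> is the right multiplication of \<open>T\<close> by \<open>v\<^sup>*\<close>, so the
  next two lemmas say that left and right multiplications commute, that is,
  \<open>u (T v\<^sup>*) = (u T) v\<^sup>*\<close>. On the matrix unit at \<open>(t, s)\<close>, both sides are the matrix of
  rank one formed from \<open>u (ket s)\<close> and \<open>v (ket t)\<close>.\<close>

lemma ampl_adj_ampl_ket:
  assumes "is_adjoint u u'" "is_adjoint v v'"
  shows "ampl u (adj (ampl v (adj (ket p)))) = adj (ampl v (adj (ampl u (ket p))))"
proof -
  obtain t s where p: "p = (t, s)" by fastforce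
  have row_ket: "row (ket (t, s)) r = (if r = t then ket s else 0)" for t s r :: 'a
    by (auto intro: ell2_eqI)
  have row: "row (adj (ampl w (ket (t, s)))) r = scaleC (cnj (ell2_apply (blinfun_apply w (ket s)) r)) (ket t)"
    for w and t s r :: 'a
    by (rule ell2_eqI) (simp add: row_ket)
  have "adj (ket (t, s)) = ket (s, t)" for t s :: 'a
    by (auto intro!: ell2_eqI)
  then show ?thesis
    unfolding p
    by (intro ell2_eqI)
      (auto simp: row row_ket is_adjoint_scaleC[OF assms(1)] is_adjoint_scaleC[OF assms(2)])
qed

text \<open>Expanding both sides as iterated sums would require an exchange of summation without
  absolute convergence. Moving the operators to the other side of the inner product with a
  matrix unit reduces the claim to the previous lemma for the adjoints.\<close>

lemma ampl_adj_ampl_commute: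
  assumes "is_adjoint u u'" "is_adjoint v v'"
  shows "ampl u (adj (ampl v (adj T))) = adj (ampl v (adj (ampl u T)))"
proof (rule ell2_eqI)
  fix p
  note adjoints = assms[THEN is_adjoint_sym]
  have "cinner (ket p) (ampl u (adj (ampl v (adj T)))) = cinner (adj (ampl v' (adj (ampl u' (ket p))))) T"
    by (simp add: cinner_adj cinner_ampl[OF adjoints(1), symmetric] cinner_ampl[OF adjoints(2)])
  also have "\<dots> = cinner (ampl u' (adj (ampl v' (adj (ket p))))) T"
    by (simp add: ampl_adj_ampl_ket[OF adjoints])
  also have "\<dots> = cinner (ket p) (adj (ampl v (adj (ampl u T))))"
    by (simp add: cinner_adj cinner_ampl[OF adjoints(1)] cinner_ampl[OF adjoints(2)])
  finally show "ell2_apply (ampl u (adj (ampl v (adj T)))) p = ell2_apply (adj (ampl v (adj (ampl u T)))) p"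
    by (simp add: cinner_ket)
qed

section \<open>Conjugation by unitaries\<close>

text \<open>This is \<open>T \<mapsto> u (u T\<^sup>*)\<^sup>* = u T u\<^sup>*\<close>.\<close>

definition conj_action :: "('i ell2 \<Rightarrow>\<^sub>L 'i ell2) \<Rightarrow> ('i \<times> 'i) ell2 \<Rightarrow> ('i \<times> 'i) ell2" where
  "conj_action u T = ampl u (adj (ampl u (adj T)))"

lemma conj_action_id: "conj_action id_blinfun T = T"
  by (simp add: conj_action_def)

lemma conj_action_add: "conj_action u (T + S) = conj_action u T + conj_action u S"
  by (simp add: conj_action_def bounded_bilinear.add_right[OF bounded_bilinear_ampl])

lemma conj_action_compose:
  assumes "is_adjoint u u'" "is_adjoint v v'"
  shows "conj_action (u o\<^sub>L v) T = conj_action u (conj_action v T)"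
  unfolding conj_action_def ampl_compose
  using ampl_adj_ampl_commute[OF assms(2,1), of "adj (ampl v (adj T))"] by simp

lemma conj_action_scaleC:
  assumes "is_adjoint u v"
  shows "conj_action u (scaleC c T) = scaleC c (conj_action u T)"
proof -
  have "ampl u (scaleC c T) = scaleC c (ampl u T)" for c and T :: "('a \<times> 'a) ell2"
    by (rule row_eqI) (simp add: is_adjoint_scaleC[OF assms])
  then show ?thesis by (simp add: conj_action_def)
qed

lemma cinner_conj_action:
  assumes "is_adjoint u v" "v o\<^sub>L u = id_blinfun"
  shows "cinner (conj_action u T) (conj_action u S) = cinner T S"
proof -
  have isometry: "cinner (ampl u T) (ampl u S) = cinner T S" for T S :: "('a \<times> 'a) ell2"
    by (simp add: cinner_ampl[OF assms(1)] assms(2) flip: ampl_compose)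
  have "cinner (adj T) (adj S) = cinner S T" for T S :: "('a \<times> 'a) ell2"
    by (simp add: cinner_adj flip: cinner_commute)
  then show ?thesis
    by (simp add: conj_action_def isometry)
qed

lemma continuous_on_conj_action: "continuous_on A (\<lambda>u. conj_action u T)"
  unfolding conj_action_def
  by (intro bounded_bilinear.continuous_on[OF bounded_bilinear_ampl]
      bounded_linear.continuous_on[OF bounded_linear_adj] continuous_intros)

lemma unitariesE:
  assumes "u \<in> unitaries A"
  obtains v where "v \<in> unitaries A" "is_adjoint u v" "u o\<^sub>L v = id_blinfun" "v o\<^sub>L u = id_blinfun"
  using assms unfolding unitaries_def by (blast dest: is_adjoint_sym)

lemma bij_conj_action:
  assumes "u \<in> unitaries A"
  shows "bij (conj_action u)"
proof -
  obtain v where v: "is_adjoint u v" "u o\<^sub>L v = id_blinfun" "v o\<^sub>L u = id_blinfun"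
    using assms by (rule unitariesE)
  show ?thesis
  proof (rule o_bij)
    show "conj_action v \<circ> conj_action u = id"
      using conj_action_compose[OF is_adjoint_sym[OF v(1)] v(1)]
      by (simp add: fun_eq_iff v(3) conj_action_id)
    show "conj_action u \<circ> conj_action v = id"
      using conj_action_compose[OF v(1) is_adjoint_sym[OF v(1)]]
      by (simp add: fun_eq_iff v(2) conj_action_id)
  qed
qed


section \<open>Bit flips exclude invariant kernels\<close>

text \<open>The Pauli matrix that exchanges the two basis vectors.\<close>

definition flip_matrix :: "complex^2^2" where
  "flip_matrix = (\<chi> a b. if a = b then 0 else 1)"

definition flip :: "nat \<Rightarrow> configuration \<Rightarrow> configuration" where
  "flip k s = s(k := s k + 1)"

lemma two_eq_zero: "(2 :: 2) = 0"
  by simp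

lemma zero_one_cases:
  fixes c :: 2
  obtains "c = 0" | "c = 1"
  using exhaust_2[of c] unfolding two_eq_zero by blast

lemma add_one_2: "(c :: 2) + 1 + 1 = c" "c + 1 \<noteq> c" "b \<noteq> c \<longleftrightarrow> b = c + 1" for b c :: 2
  by (cases b rule: zero_one_cases; cases c rule: zero_one_cases; simp)+

lemma flip_flip [simp]: "flip k (flip k s) = s"
  by (simp add: flip_def add_one_2)

lemma flip_eq_iff: "flip j s = flip k s \<longleftrightarrow> j = k"
proof
  assume *: "flip j s = flip k s"
  show "j = k"
  proof (rule ccontr)
    assume "j \<noteq> k"
    then show False
      using fun_cong[OF *, of j] by (simp add: flip_def add_one_2)
  qed
qed simp

lemma site_flip_apply:
  "ell2_apply (blinfun_apply (site k flip_matrix) x) s = ell2_apply x (flip k s)"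
proof -
  have "site_fun k flip_matrix (ell2_apply x) s = (\<Sum>b\<in>UNIV. if b = s k + 1 then ell2_apply x (s(k := b)) else 0)"
    unfolding site_fun_def
  proof (rule sum.cong)
    show "flip_matrix $ s k $ b * ell2_apply x (s(k := b)) =
        (if b = s k + 1 then ell2_apply x (s(k := b)) else 0)" for b
      using add_one_2(3)[of b "s k"] by (auto simp: flip_matrix_def)
  qed simp
  then show ?thesis
    by (simp add: site_apply flip_def)
qed

lemma site_in_car_algebra: "site k m \<in> car_algebra"
proof -
  let ?a = "\<lambda>i. if i = k then m else mat 1"
  have "elementary_tensor ?a n = id_blinfun" if "n \<le> k" for n
    using that by (induction n) (simp_all add: site_one)
  then have "elementary_tensor ?a (Suc k) = site k m"
    by simp
  then have "site k m \<in> tensor_power (Suc k)"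
    unfolding tensor_power_def by (metis rangeI span_base)
  then show ?thesis
    unfolding car_algebra_def by (intro subsetD[OF closure_subset] UN_I[of "Suc k"]) auto
qed

lemma site_flip_unitary: "site k flip_matrix \<in> unitaries car_algebra"
proof -
  let ?u = "site k flip_matrix"
  have "bij (flip k)"
    by (rule o_bij[of "flip k"]) (simp_all add: fun_eq_iff)
  have "is_adjoint ?u ?u"
    unfolding is_adjoint_def
  proof (intro allI)
    fix x y
    show "cinner (blinfun_apply ?u x) y = cinner x (blinfun_apply ?u y)"
      using infsum_reindex_bij_betw[OF \<open>bij (flip k)\<close>,
          of "\<lambda>s. cnj (ell2_apply x s) * ell2_apply y (flip k s)"]
      by (simp add: cinner.rep_eq site_flip_apply)
  qed
  moreover have "?u o\<^sub>L ?u = id_blinfun"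
    by (rule car_operator_eqI) (simp add: site_flip_apply)
  ultimately show ?thesis
    using site_in_car_algebra by (auto simp: unitaries_def)
qed

lemma conj_action_flip_apply:
  "ell2_apply (conj_action (site k flip_matrix) T) (t, s) = ell2_apply T (flip k t, flip k s)"
  by (simp add: conj_action_def site_flip_apply)

text \<open>For every \<open>n\<close>, some \<open>n\<close> entries equal to \<open>c\<close> contribute \<open>n * (cmod c)\<^sup>2\<close> to the fixed
  number \<open>(norm x)\<^sup>2\<close>.\<close>

lemma ell2_constant_on_infinite:
  assumes "infinite I" "\<And>i. i \<in> I \<Longrightarrow> ell2_apply x i = c"
  shows "c = 0"
proof (rule ccontr)
  assume "c \<noteq> 0"
  then obtain n :: nat where n: "(norm x)\<^sup>2 < real n * (cmod c)\<^sup>2"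
    using ex_less_of_nat_mult[of "(cmod c)\<^sup>2"] by auto
  obtain F where F: "F \<subseteq> I" "finite F" "card F = n"
    using infinite_arbitrarily_large[OF assms(1)] by blast
  have "real n * (cmod c)\<^sup>2 = (\<Sum>i\<in>F. (cmod (ell2_apply x i))\<^sup>2)"
    using F assms(2) by (simp add: subset_iff)
  also have "\<dots> \<le> (norm x)\<^sup>2"
    unfolding power2_norm_ell2 using F(2) by (intro finite_sum_le_infsum summable_ell2) auto
  finally show False using n by simp
qed

text \<open>Flipping different bits of a configuration gives different configurations, so the flips
  copy every entry of an invariant kernel to infinitely many places.\<close>

lemma conj_action_invariant_zero:
  assumes "\<And>u. u \<in> unitaries car_algebra \<Longrightarrow> conj_action u T = T"
  shows "T = 0"
proof (rule row_eqI, rule ell2_eqI)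
  fix t s
  have "infinite (range (\<lambda>k. (flip k t, flip k s)))"
    by (intro range_inj_infinite injI) (simp add: flip_eq_iff)
  moreover have "ell2_apply T (flip k t, flip k s) = ell2_apply T (t, s)" for k
    using assms[OF site_flip_unitary[of k]] conj_action_flip_apply[of k T t s] by simp
  ultimately have "ell2_apply T (t, s) = 0"
    using ell2_constant_on_infinite[of "range (\<lambda>k. (flip k t, flip k s))" T "ell2_apply T (t, s)"]
    by auto
  then show "ell2_apply (row T t) s = ell2_apply (row 0 t) s" by simp
qed


section \<open>Projections that are almost invariant\<close>

definition corner :: "nat \<Rightarrow> configuration set" where
  "corner n = {s. \<forall>k\<ge>n. s k = 1}"

lemma finite_corner: "finite (corner n)"
proof (induction n)
  case 0
  have "corner 0 = {\<lambda>_. 1}" by (auto simp: corner_def)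
  then show ?case by simp
next
  case (Suc n)
  have "corner (Suc n) \<subseteq> (\<Union>b. (\<lambda>s. s(n := b)) ` corner n)"
  proof
    fix s assume "s \<in> corner (Suc n)"
    then have "s(n := 1) \<in> corner n" "s = (s(n := 1))(n := s n)"
      by (auto simp: corner_def)
    then show "s \<in> (\<Union>b. (\<lambda>s. s(n := b)) ` corner n)" by blast
  qed
  then show ?case
    using Suc by (auto intro: finite_subset)
qed

text \<open>Operators that act on the positions below \<open>n\<close> do not change the tail of a configuration, so
  they preserve the span of \<open>corner n\<close>.\<close>

lemma elementary_tensor_corner:
  assumes "m \<le> n" "\<And>s. s \<notin> corner n \<Longrightarrow> ell2_apply x s = 0" "s \<notin> corner n"
  shows "ell2_apply (blinfun_apply (elementary_tensor c m) x) s = 0"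
  using assms
proof (induction m arbitrary: x s)
  case (Suc m)
  have "ell2_apply (blinfun_apply (site m (c m)) x) s = 0" if "s \<notin> corner n" for s
  proof -
    have "s(m := b) \<notin> corner n" for b
      using that Suc.prems(1) by (auto simp: corner_def)
    then have "ell2_apply x (s(m := b)) = 0" for b
      by (rule Suc.prems(2))
    then show ?thesis
      by (simp add: site_apply site_fun_def)
  qed
  then show ?case
    using Suc.IH[of "blinfun_apply (site m (c m)) x" s] Suc.prems by simp
qed simp

lemma tensor_power_corner:
  assumes "a \<in> tensor_power n" "s \<in> corner n" "t \<notin> corner n"
  shows "ell2_apply (blinfun_apply a (ket s)) t = 0"
  using assms(1) unfolding tensor_power_def
proof (induction rule: span_induct_alt)
  case (step r b z)
  have "ell2_apply (blinfun_apply b (ket s)) t = 0"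
    using step assms by (auto intro!: elementary_tensor_corner[of n n])
  then show ?case
    using step by (simp add: blinfun.bilinear_simps)
qed simp

text \<open>The matrix of the orthogonal projection onto the span of the vectors \<open>ket s\<close> with
  \<open>s \<in> F\<close>.\<close>

definition diag_proj :: "'i set \<Rightarrow> ('i \<times> 'i) ell2" where
  "diag_proj F = (\<Sum>s\<in>F. ket (s, s))"

lemma diag_proj_apply:
  assumes "finite F"
  shows "ell2_apply (diag_proj F) (t, s) = (if t = s \<and> s \<in> F then 1 else 0)"
proof -
  have "ell2_apply (sum f F) p = (\<Sum>i\<in>F. ell2_apply (f i) p)" for f :: "'a \<Rightarrow> ('a \<times> 'a) ell2" and p
    by (induction F rule: infinite_finite_induct) simp_all
  then show ?thesis
    using assms by (auto simp: diag_proj_def sum.delta' intro!: sum.neutral)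
qed

lemma row_diag_proj: "finite F \<Longrightarrow> row (diag_proj F) t = (if t \<in> F then ket t else 0)"
  by (rule ell2_eqI) (auto simp: diag_proj_apply)

text \<open>This estimate serves vectors whose entries are controlled by \<open>y\<close> on one part of the index set
  and by \<open>z\<close> on the rest, without cutting \<open>y\<close> and \<open>z\<close> down to these parts.\<close>

lemma norm_ell2_le_add:
  assumes "\<And>i. cmod (ell2_apply x i) \<le> cmod (ell2_apply y i) \<or> cmod (ell2_apply x i) \<le> cmod (ell2_apply z i)"
  shows "norm x \<le> norm y + norm z"
proof (rule norm_ell2_boundedI)
  fix F :: "'a set" assume F: "finite F"
  have le: "(\<Sum>i\<in>F. (cmod (ell2_apply w i))\<^sup>2) \<le> (norm w)\<^sup>2" for w :: "'a ell2"
    unfolding power2_norm_ell2 using F by (intro finite_sum_le_infsum summable_ell2) auto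
  have "(\<Sum>i\<in>F. (cmod (ell2_apply x i))\<^sup>2) \<le> (\<Sum>i\<in>F. (cmod (ell2_apply y i))\<^sup>2 + (cmod (ell2_apply z i))\<^sup>2)"
  proof (rule sum_mono)
    fix i
    show "(cmod (ell2_apply x i))\<^sup>2 \<le> (cmod (ell2_apply y i))\<^sup>2 + (cmod (ell2_apply z i))\<^sup>2"
      using assms[of i] by (auto dest: power_mono[of _ _ 2] intro: add_increasing add_increasing2)
  qed
  also have "\<dots> \<le> (norm y)\<^sup>2 + (norm z)\<^sup>2"
    unfolding sum.distrib by (intro add_mono le)
  also have "\<dots> \<le> (norm y + norm z)\<^sup>2"
    by (simp add: power2_sum)
  finally show "(\<Sum>i\<in>F. (cmod (ell2_apply x i))\<^sup>2) \<le> (norm y + norm z)\<^sup>2" .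
qed simp

text \<open>With \<open>P\<close> the projection and \<open>v = u\<^sup>*\<close>, the difference \<open>u P v - P\<close> equals \<open>u (P v - v P)\<close>.
  The entries of \<open>P v - v P\<close> vanish within \<open>F\<close> and within its complement. Those from
  \<open>F\<close> to the complement are entries of \<open>- v\<close>, where those of \<open>b\<close> vanish, so they are not changed if
  \<open>v\<close> is replaced by \<open>v - b\<close>. Those from the complement to \<open>F\<close> are conjugates of entries of \<open>u\<close> in
  the opposite direction, where in the same way \<open>u\<close> can be replaced by \<open>u - a\<close>.\<close>

lemma conj_action_diag_proj:
  assumes F: "finite F"
    and v: "is_adjoint u v" "u o\<^sub>L v = id_blinfun" and u: "norm u \<le> 1"
    and a: "\<And>s t. s \<in> F \<Longrightarrow> t \<notin> F \<Longrightarrow> ell2_apply (blinfun_apply a (ket s)) t = 0"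
    and b: "\<And>s t. s \<in> F \<Longrightarrow> t \<notin> F \<Longrightarrow> ell2_apply (blinfun_apply b (ket s)) t = 0"
  shows "norm (conj_action u (diag_proj F) - diag_proj F) \<le> (norm (u - a) + norm (v - b)) * norm (diag_proj F)"
proof -
  let ?P = "diag_proj F"
  define D where "D = adj (ampl u ?P) - ampl v ?P"
  have adj: "adj ?P = ?P"
    using F by (auto intro!: ell2_eqI simp: diag_proj_apply)
  have "?P = ampl u (ampl v ?P)"
    by (simp add: v(2) flip: ampl_compose)
  then have "conj_action u ?P - ?P = ampl u D"
    by (simp add: conj_action_def D_def adj bounded_bilinear.diff_right[OF bounded_bilinear_ampl])
  then have "norm (conj_action u ?P - ?P) \<le> norm u * norm D"
    by (simp add: norm_ampl_le)
  also have "\<dots> \<le> norm D"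
    using u by (simp add: mult_left_le_one_le)
  also have "\<dots> \<le> norm (adj (ampl (u - a) ?P)) + norm (ampl (v - b) ?P)"
  proof (rule norm_ell2_le_add)
    fix p :: "'a \<times> 'a"
    obtain t s where p: "p = (t, s)" by fastforce
    have "cnj (ell2_apply (blinfun_apply u (ket s)) t) = ell2_apply (blinfun_apply v (ket t)) s"
      using v(1) by (metis cinner_commute cinner_ket is_adjoint_def)
    then show "cmod (ell2_apply D p) \<le> cmod (ell2_apply (adj (ampl (u - a) ?P)) p) \<or>
        cmod (ell2_apply D p) \<le> cmod (ell2_apply (ampl (v - b) ?P) p)"
      by (cases "s \<in> F"; cases "t \<in> F")
        (simp_all add: p D_def row_diag_proj[OF F] blinfun.bilinear_simps a b)
  qed
  also have "\<dots> \<le> norm (u - a) * norm ?P + norm (v - b) * norm ?P"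
    by (intro add_mono) (simp_all add: norm_ampl_le)
  finally show ?thesis
    by (simp add: distrib_right)
qed

text \<open>The open \<open>\<delta>\<close>-neighbourhoods of the tensor powers cover the algebra and increase, so one of
  them contains a given compact set.\<close>

lemma compact_car_algebra_approx:
  assumes "compact K" "K \<subseteq> car_algebra" "0 < \<delta>"
  obtains n where "\<And>u. u \<in> K \<Longrightarrow> \<exists>a\<in>tensor_power n. norm (u - a) < \<delta>"
proof -
  define W where "W n = (\<Union>a\<in>tensor_power n. ball a \<delta>)" for n
  have cover: "K \<subseteq> (\<Union>n. W n)"
  proof
    fix u assume "u \<in> K"
    then have "u \<in> closure (\<Union>n. tensor_power n)"
      using assms(2) by (auto simp: car_algebra_def)
    then show "u \<in> (\<Union>n. W n)"
      using \<open>0 < \<delta>\<close> by (auto simp: closure_approachable W_def)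
  qed
  have "open (W n)" for n by (auto simp: W_def)
  then obtain C where C: "finite C" "K \<subseteq> (\<Union>n\<in>C. W n)"
    by (rule compactE_image[OF assms(1) _ cover])
  have "\<exists>a\<in>tensor_power (Max (insert 0 C)). norm (u - a) < \<delta>" if "u \<in> K" for u
  proof -
    obtain n a where "n \<in> C" "a \<in> tensor_power n" "dist a u < \<delta>"
      using C(2) \<open>u \<in> K\<close> by (auto simp: W_def)
    moreover have "n \<le> Max (insert 0 C)"
      using C(1) \<open>n \<in> C\<close> by simp
    ultimately show ?thesis
      using tensor_power_mono by (metis dist_commute dist_norm subsetD)
  qed
  then show thesis by (rule that)
qed

lemma conj_action_almost_invariant:
  assumes Q: "compactin (norm_topology car_algebra) Q" and "0 < \<epsilon>"
  shows "\<exists>T. T \<noteq> 0 \<and> (\<forall>u\<in>Q. norm (conj_action u T - T) \<le> \<epsilon> * norm T)"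
proof -
  let ?G = "unitary_group car_algebra" and ?T = "norm_topology car_algebra"
  interpret group ?G
    using topological_group_car by (simp add: topological_group_def)
  \<comment> \<open>The projection must nearly commute with \<open>u\<close> and with its adjoint, so the compact set is
    closed under inverses.\<close>
  define K where "K = Q \<union> (\<lambda>u. inv\<^bsub>?G\<^esub> u) ` Q"
  have "compactin ?T K"
    unfolding K_def using Q topological_group_car
    by (intro compactin_Un image_compactin[of ?T]) (auto simp: topological_group_def)
  then have K: "compact K" "K \<subseteq> unitaries car_algebra"
    by (auto simp: norm_topology_def compactin_subtopology)
  then have "K \<subseteq> car_algebra"
    by (auto simp: unitaries_def)
  then obtain n where n: "\<And>u. u \<in> K \<Longrightarrow> \<exists>a\<in>tensor_power n. norm (u - a) < \<epsilon> / 2"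
    using compact_car_algebra_approx[OF K(1), of "\<epsilon> / 2"] \<open>0 < \<epsilon>\<close> by auto
  let ?P = "diag_proj (corner n)"
  have "norm (conj_action u ?P - ?P) \<le> \<epsilon> * norm ?P" if "u \<in> Q" for u
  proof -
    have u: "u \<in> unitaries car_algebra"
      using K(2) that by (auto simp: K_def)
    then obtain v where v: "v \<in> unitaries car_algebra" "is_adjoint u v"
      "u o\<^sub>L v = id_blinfun" "v o\<^sub>L u = id_blinfun"
      by (rule unitariesE)
    have "inv\<^bsub>?G\<^esub> u = v"
      using u v by (intro inv_equality) (simp_all add: unitary_group_def)
    then have "v \<in> K" "u \<in> K"
      using that by (auto simp: K_def)
    then obtain a b where ab: "a \<in> tensor_power n" "norm (u - a) < \<epsilon> / 2"
      "b \<in> tensor_power n" "norm (v - b) < \<epsilon> / 2"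
      using n by metis
    have "norm (conj_action u ?P - ?P) \<le> (norm (u - a) + norm (v - b)) * norm ?P"
      using v(2,3) norm_unitary_le[OF u] tensor_power_corner[OF ab(1)] tensor_power_corner[OF ab(3)]
      by (intro conj_action_diag_proj finite_corner)
    also have "\<dots> \<le> \<epsilon> * norm ?P"
      using ab by (intro mult_right_mono) auto
    finally show ?thesis .
  qed
  moreover have "?P \<noteq> 0"
  proof -
    have "(\<lambda>_. 1) \<in> corner n"
      by (simp add: corner_def)
    then have "ell2_apply ?P (\<lambda>_. 1, \<lambda>_. 1) = 1"
      by (simp add: diag_proj_apply[OF finite_corner])
    then show ?thesis by auto
  qed
  ultimately show ?thesis by blast
qed


section \<open>The unitary group of the CAR algebra\<close>

text \<open>A set of operators can encode any set of natural numbers through the multiples of the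
  identity that it contains. The even numbers record the first configuration and the odd
  numbers the second.\<close>

lemma surj_config_pairs: "\<exists>g :: car_operator set \<times> nat \<times> car_operator \<Rightarrow> configuration \<times> configuration. surj g"
proof -
  have "id_blinfun \<noteq> (0 :: car_operator)"
  proof
    assume "id_blinfun = (0 :: car_operator)"
    then have "ket (\<lambda>_. 1) = (0 :: configuration ell2)"
      by (metis blinfun_apply_id_blinfun zero_blinfun.rep_eq)
    then show False
      by (metis ell2_apply_simps(1) ket_apply zero_neq_one)
  qed
  define c :: "nat \<Rightarrow> car_operator" where "c n = real n *\<^sub>R id_blinfun" for n
  have "inj c"
    using \<open>id_blinfun \<noteq> 0\<close> by (auto simp: c_def inj_def)
  define g :: "car_operator set \<times> nat \<times> car_operator \<Rightarrow> configuration \<times> configuration" where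
    "g p = (\<lambda>k. if c (2 * k) \<in> fst p then 1 else 0, \<lambda>k. if c (2 * k + 1) \<in> fst p then 1 else 0)" for p
  have "(t, s) \<in> range g" for t s
  proof -
    define B where "B = {n. if even n then t (n div 2) = 1 else s (n div 2) = 1}"
    have "b \<noteq> 1 \<Longrightarrow> b = 0" for b :: 2
      by (cases b rule: zero_one_cases) auto
    then have "g (c ` B, 0, 0) = (t, s)"
      by (auto simp: g_def inj_image_mem_iff[OF \<open>inj c\<close>] B_def fun_eq_iff)
    then show ?thesis by (metis rangeI)
  qed
  then have "surj g" by auto
  then show ?thesis by blast
qed

theorem proposition4p37:
  shows "\<not> property_T (unitary_group car_algebra) (norm_topology car_algebra)"
proof -
  obtain g :: "car_operator set \<times> nat \<times> car_operator \<Rightarrow> configuration \<times> configuration" where g: "surj g"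
    using surj_config_pairs by blast
  have carrier: "carrier (unitary_group car_algebra) = unitaries car_algebra"
    by (simp add: unitary_group_def)
  have adjoint: "\<exists>v. is_adjoint u v \<and> v o\<^sub>L u = id_blinfun" if "u \<in> unitaries car_algebra" for u
    using that by (auto simp: unitaries_def)
  show ?thesis
  proof (rule not_property_T_ell2[OF g, where \<rho> = conj_action], unfold carrier)
    fix u v assume "u \<in> unitaries car_algebra" "v \<in> unitaries car_algebra"
    then obtain u' v' where "is_adjoint u u'" "is_adjoint v v'"
      using adjoint by blast
    then show "conj_action (u \<otimes>\<^bsub>unitary_group car_algebra\<^esub> v) = conj_action u \<circ> conj_action v"
      by (simp add: unitary_group_def fun_eq_iff conj_action_compose)
  next
    fix u :: car_operator and c \<xi> \<eta> assume u: "u \<in> unitaries car_algebra"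
    then obtain v where v: "is_adjoint u v" "v o\<^sub>L u = id_blinfun"
      using adjoint by blast
    show "bij (conj_action u)"
      using u by (rule bij_conj_action)
    show "conj_action u (\<xi> + \<eta>) = conj_action u \<xi> + conj_action u \<eta>"
      by (rule conj_action_add)
    show "conj_action u (scaleC c \<xi>) = scaleC c (conj_action u \<xi>)"
      using v(1) by (rule conj_action_scaleC)
    show "cinner (conj_action u \<xi>) (conj_action u \<eta>) = cinner \<xi> \<eta>"
      using v by (rule cinner_conj_action)
  next
    show "continuous_map (norm_topology car_algebra) euclidean (\<lambda>u. conj_action u \<xi>)" for \<xi>
      by (simp add: norm_topology_def continuous_on_conj_action)
  next
    fix Q and \<epsilon> :: real assume "compactin (norm_topology car_algebra) Q" "0 < \<epsilon>"
    then show "\<exists>\<xi>. \<xi> \<noteq> 0 \<and> (\<forall>u\<in>Q. norm (conj_action u \<xi> - \<xi>) \<le> \<epsilon> * norm \<xi>)"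
      by (rule conj_action_almost_invariant)
  next
    fix \<xi> :: "(configuration \<times> configuration) ell2"
    assume "\<And>u. u \<in> unitaries car_algebra \<Longrightarrow> conj_action u \<xi> = \<xi>"
    then show "\<xi> = 0"
      by (rule conj_action_invariant_zero)
  qed
qed

end
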